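(* For the system $$\dot x=(u+y^2+z^2)x,\quad \dot y=(u+y^2-2z^2)y,\quad \dot z=(u-2y^2+z^2)z,\quad \dot u=u^2-y^4+y^2z^2-z^4$$ with $X=(x,y,z,u)^{\top}$, let $\mathcal{H},\boldsymbol{J}_1,\boldsymbol{J}_2,\omega$ be as in the context, let $I_1=(\lambda\boldsymbol{J}_1)^{-1}$, $I_2=\boldsymbol{J}_2$ with a constant $\lambda\neq0$, and define the Nambu 4-bracket $$\{f_1,f_2,f_3,f_4\}=\Xi^{-1}(X)\,\varepsilon^{jk\ell n}\,\nabla_jf_1\,\nabla_kf_2\,\nabla_\ell f_3\,\nabla_nf_4,\qquad \Xi^{-1}=\frac2\pi\,\lambda\,\boldsymbol{J}_1^2\,x^3yz .$$ Then the rational Poisson bracket $\omega$ is the reduction of this Nambu bracket with respect to the integrals $I_1,I_2$: $$\{f_1,f_2\}_\omega=\{f_1,f_2,I_2,I_1\},\qquad\text{i.e.}\qquad \omega^{jk}=\frac2\pi\,x^3yz\;\varepsilon^{jk\ell n}\,\nabla_\ell\boldsymbol{J}_1\,\nabla_n\boldsymbol{J}_2,$$ and the system is a generalized Nambu mechanics with the triple of Hamiltonians $\mathcal{H},I_1,I_2$: $$\dot X=\{X,\mathcal{H},I_2,I_1\}\quad\Longleftrightarrow\quad \dot X=\{X,\mathcal{H}\}_\omega .$$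
   Context: $\varepsilon^{jk\ell n}$ is the Levi-Civita symbol with $\varepsilon^{1234}=1$; $\nabla_j=\partial/\partial X^j$; summation over repeated indices; $\{f,g\}_\omega=\omega^{jk}\nabla_jf\,\nabla_kg$. Here $\mathcal{H}=\frac12\frac{y^2-z^2}{x^2}$ and $$\omega=\frac{x}{2\mathcal{H}}\begin{pmatrix}0&V_y&V_z&V_u\\-V_y&0&0&0\\-V_z&0&0&0\\-V_u&0&0&0\end{pmatrix},$$ $$V_y=(u+y^2-2z^2)y,\quad V_z=(u-2y^2+z^2)z,\quad V_u=u^2-y^4+y^2z^2-z^4,$$ $$\boldsymbol{J}_1=\tfrac1y(u-2y^2+z^2)K\big(\tfrac zy\big)+3yE\big(\tfrac zy\big),\qquad \boldsymbol{J}_2=\tfrac1y(u+y^2+z^2)K'\big(\tfrac zy\big)-3yE'\big(\tfrac zy\big),$$ with the Legendre complete elliptic integrals $$K(k)=\int_0^1\frac{d\lambda}{\sqrt{(1-\lambda^2)(1-k^2\lambda^2)}},\quad K'(k)=\int_k^1\frac{d\lambda}{\sqrt{(1-\lambda^2)(\lambda^2-k^2)}},$$ $$E(k)=\int_0^1\sqrt{\frac{1-k^2\lambda^2}{1-\lambda^2}}\,d\lambda,\quad E'(k)=\int_0^1\sqrt{\frac{1-(1-k^2)\lambda^2}{1-\lambda^2}}\,d\lambda$$ (the prime is not a derivative). *)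

theory Defs
  imports "HOL-Analysis.Analysis" "HOL-Combinatorics.Permutations"
begin

text \<open>
  Points of the phase space are \<open>X = (x, y, z, u)\<close>, i.e. \<open>X $ 1\<close>, \<open>X $ 2\<close>, \<open>X $ 3\<close>, \<open>X $ 4\<close>.
  In the index type \<open>4\<close> arithmetic is modulo 4, so \<open>4 = 0\<close> and its order is not the order of
  the labels 1, 2, 3, 4; nothing below refers to that order.
\<close>

definition nabla :: "4 \<Rightarrow> (real^4 \<Rightarrow> real) \<Rightarrow> real^4 \<Rightarrow> real" where
  "nabla j f X = deriv (\<lambda>t. f (X + t *\<^sub>R axis j 1)) 0"

definition levi_civita :: "4 \<Rightarrow> 4 \<Rightarrow> 4 \<Rightarrow> 4 \<Rightarrow> real" where
  "levi_civita j k l n =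
     (let p = (\<lambda>i::4. if i = 1 then j else if i = 2 then k else if i = 3 then l else n)
      in if p permutes UNIV then of_int (sign p) else 0)"

lemma levi_civita_1234: "levi_civita 1 2 3 4 = 1"
proof -
  have "i = 4" if "i \<noteq> 1" "i \<noteq> 2" "i \<noteq> 3" for i :: 4
    using exhaust_4[of i] that by blast
  then have "(\<lambda>i::4. if i = 1 then 1 else if i = 2 then 2 else if i = 3 then 3 else 4) = id"
    by (auto simp: fun_eq_iff)
  then show ?thesis
    unfolding levi_civita_def Let_def by (simp add: sign_id permutes_id)
qed


subsection \<open>Complete elliptic integrals\<close>

text \<open>
  The integrands are nonnegative, so the Henstock--Kurzweil integral agrees with the improper
  integral; at singular endpoints division by zero gives the irrelevant value 0. The
  functions \<open>ell_K'\<close> and \<open>ell_E'\<close> are not derivatives. All four are meant for \<open>0 < k < 1\<close>.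
\<close>

definition ell_K :: "real \<Rightarrow> real" where
  "ell_K k = integral {0..1} (\<lambda>s. 1 / sqrt ((1 - s\<^sup>2) * (1 - k\<^sup>2 * s\<^sup>2)))"

definition ell_K' :: "real \<Rightarrow> real" where
  "ell_K' k = integral {k..1} (\<lambda>s. 1 / sqrt ((1 - s\<^sup>2) * (s\<^sup>2 - k\<^sup>2)))"

definition ell_E :: "real \<Rightarrow> real" where
  "ell_E k = integral {0..1} (\<lambda>s. sqrt ((1 - k\<^sup>2 * s\<^sup>2) / (1 - s\<^sup>2)))"

definition ell_E' :: "real \<Rightarrow> real" where
  "ell_E' k = integral {0..1} (\<lambda>s. sqrt ((1 - (1 - k\<^sup>2) * s\<^sup>2) / (1 - s\<^sup>2)))"


subsection \<open>The system, its integrals and the bivector\<close>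

definition V_y :: "real^4 \<Rightarrow> real" where
  "V_y X = (let y = X$2; z = X$3; u = X$4 in (u + y^2 - 2 * z^2) * y)"

definition V_z :: "real^4 \<Rightarrow> real" where
  "V_z X = (let y = X$2; z = X$3; u = X$4 in (u - 2 * y^2 + z^2) * z)"

definition V_u :: "real^4 \<Rightarrow> real" where
  "V_u X = (let y = X$2; z = X$3; u = X$4 in u^2 - y^4 + y^2 * z^2 - z^4)"

definition system_field :: "real^4 \<Rightarrow> real^4" where
  "system_field X =
     (let x = X$1; y = X$2; z = X$3; u = X$4 in
      vector [(u + y^2 + z^2) * x,
              (u + y^2 - 2 * z^2) * y,
              (u - 2 * y^2 + z^2) * z,
              u^2 - y^4 + y^2 * z^2 - z^4])"

definition Ham :: "real^4 \<Rightarrow> real" where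
  "Ham X = (let x = X$1; y = X$2; z = X$3 in 1 / 2 * ((y^2 - z^2) / x^2))"

definition J1 :: "real^4 \<Rightarrow> real" where
  "J1 X = (let y = X$2; z = X$3; u = X$4 in
     1 / y * (u - 2 * y^2 + z^2) * ell_K (z / y) + 3 * y * ell_E (z / y))"

definition J2 :: "real^4 \<Rightarrow> real" where
  "J2 X = (let y = X$2; z = X$3; u = X$4 in
     1 / y * (u + y^2 + z^2) * ell_K' (z / y) - 3 * y * ell_E' (z / y))"

definition I1 :: "real \<Rightarrow> real^4 \<Rightarrow> real" where
  "I1 lam X = inverse (lam * J1 X)"

definition I2 :: "real^4 \<Rightarrow> real" where
  "I2 X = J2 X"

definition omega :: "real^4 \<Rightarrow> real^4^4" where
  "omega X = (X$1 / (2 * Ham X)) *\<^sub>R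
     vector [vector [0,        V_y X, V_z X, V_u X],
             vector [- V_y X,  0,     0,     0],
             vector [- V_z X,  0,     0,     0],
             vector [- V_u X,  0,     0,     0]]"

lemma vector_4:
  fixes a b c d :: "'a::zero"
  shows "(vector [a, b, c, d] :: 'a^4) $ 1 = a"
    and "(vector [a, b, c, d] :: 'a^4) $ 2 = b"
    and "(vector [a, b, c, d] :: 'a^4) $ 3 = c"
    and "(vector [a, b, c, d] :: 'a^4) $ 4 = d"
  unfolding vector_def by simp_all

lemma omega_first_row:
  "omega X $ 1 $ 1 = 0"
  "omega X $ 1 $ 2 = X$1 / (2 * Ham X) * V_y X"
  "omega X $ 1 $ 3 = X$1 / (2 * Ham X) * V_z X"
  "omega X $ 1 $ 4 = X$1 / (2 * Ham X) * V_u X"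
  by (simp_all add: omega_def vector_4)

text \<open>
  The real domain on which all the objects are defined: \<open>\<H>\<close> and \<open>1 / \<H>\<close> require
  \<open>x \<noteq> 0\<close> and \<open>y\<^sup>2 \<noteq> z\<^sup>2\<close>, and \<open>K\<close>, \<open>K'\<close>, \<open>E\<close>, \<open>E'\<close> require a modulus
  \<open>z / y\<close> strictly between 0 and 1 (so \<open>y \<noteq> 0\<close>). The integral \<open>I\<^sub>1\<close> moreover requires
  \<open>J\<^sub>1 \<noteq> 0\<close>.
\<close>

definition phase_dom :: "(real^4) set" where
  "phase_dom = {X. X$1 \<noteq> 0 \<and> 0 < X$3 / X$2 \<and> X$3 / X$2 < 1}"

definition nambu_dom :: "(real^4) set" where
  "nambu_dom = {X \<in> phase_dom. J1 X \<noteq> 0}"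


subsection \<open>Brackets\<close>

definition omega_bracket ::
    "(real^4 \<Rightarrow> real) \<Rightarrow> (real^4 \<Rightarrow> real) \<Rightarrow> real^4 \<Rightarrow> real" where
  "omega_bracket f g X = (\<Sum>j\<in>UNIV. \<Sum>k\<in>UNIV. omega X $ j $ k * nabla j f X * nabla k g X)"

definition poisson_tensor_on :: "(real^4) set \<Rightarrow> (real^4 \<Rightarrow> real^4^4) \<Rightarrow> bool" where
  "poisson_tensor_on S w \<longleftrightarrow>
     (\<forall>X\<in>S. w differentiable (at X) \<and>
        (\<forall>j k. w X $ j $ k = - (w X $ k $ j)) \<and>
        (\<forall>i j k. (\<Sum>l\<in>UNIV.
             w X $ i $ l * nabla l (\<lambda>Y. w Y $ j $ k) X
           + w X $ j $ l * nabla l (\<lambda>Y. w Y $ k $ i) X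
           + w X $ k $ l * nabla l (\<lambda>Y. w Y $ i $ j) X) = 0))"

text \<open>The multiplier \<open>\<Xi>\<close> to the power \<open>-1\<close>.\<close>

definition Xi_inv :: "real \<Rightarrow> real^4 \<Rightarrow> real" where
  "Xi_inv lam X = 2 / pi * lam * (J1 X)^2 * (X$1)^3 * X$2 * X$3"

definition nambu_bracket :: "real \<Rightarrow> (real^4 \<Rightarrow> real) \<Rightarrow> (real^4 \<Rightarrow> real) \<Rightarrow>
    (real^4 \<Rightarrow> real) \<Rightarrow> (real^4 \<Rightarrow> real) \<Rightarrow> real^4 \<Rightarrow> real" where
  "nambu_bracket lam f1 f2 f3 f4 X = Xi_inv lam X *
     (\<Sum>j\<in>UNIV. \<Sum>k\<in>UNIV. \<Sum>l\<in>UNIV. \<Sum>n\<in>UNIV.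
        levi_civita j k l n * nabla j f1 X * nabla k f2 X * nabla l f3 X * nabla n f4 X)"

text \<open>\<open>{X, g}\<close> and \<open>{X, g, h, k}\<close>: the bracket with each coordinate function.\<close>

definition omega_field :: "(real^4 \<Rightarrow> real) \<Rightarrow> real^4 \<Rightarrow> real^4" where
  "omega_field g X = (\<chi> i. omega_bracket (\<lambda>Y. Y $ i) g X)"

definition nambu_field :: "real \<Rightarrow> (real^4 \<Rightarrow> real) \<Rightarrow> (real^4 \<Rightarrow> real) \<Rightarrow>
    (real^4 \<Rightarrow> real) \<Rightarrow> real^4 \<Rightarrow> real^4" where
  "nambu_field lam g h k X = (\<chi> i. nambu_bracket lam (\<lambda>Y. Y $ i) g h k X)"


subsection \<open>Motions and integrals\<close>

definition solves_on :: "(real^4 \<Rightarrow> real^4) \<Rightarrow> real set \<Rightarrow> (real \<Rightarrow> real^4) \<Rightarrow> bool" where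
  "solves_on F T c \<longleftrightarrow> (\<forall>t\<in>T. (c has_vector_derivative F (c t)) (at t))"

definition integral_of_motion_on ::
    "(real^4) set \<Rightarrow> (real^4 \<Rightarrow> real^4) \<Rightarrow> (real^4 \<Rightarrow> real) \<Rightarrow> bool" where
  "integral_of_motion_on S F I \<longleftrightarrow>
     (\<forall>T c. open T \<longrightarrow> is_interval T \<longrightarrow> c ` T \<subseteq> S \<longrightarrow> solves_on F T c \<longrightarrow>
        (\<exists>C. \<forall>t\<in>T. I (c t) = C))"

end

theory Submission
  imports Defs
begin

text \<open>
  The bivector \<open>\<epsilon>\<^sup>j\<^sup>k\<^sup>l\<^sup>n \<nabla>\<^sub>lJ\<^sub>1 \<nabla>\<^sub>nJ\<^sub>2\<close> is rational although \<open>J\<^sub>1\<close> and \<open>J\<^sub>2\<close> are elliptic integrals, and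
  the reason is Legendre's relation \<open>E K' + E' K - K K' = \<pi>/2\<close>. As \<open>J\<^sub>1\<close> and \<open>J\<^sub>2\<close> do not depend on
  \<open>x\<close>, only the entries with one index equal to 1 survive, and these are the components of the
  cross product of the two gradients in \<open>(y, z, u)\<close>. The classical formulas for \<open>dK/dk\<close> and
  \<open>dE/dk\<close> make the gradient of \<open>J\<^sub>1\<close> a combination of \<open>K, E\<close> and that of \<open>J\<^sub>2\<close> a combination of
  \<open>K', E'\<close>, with rational coefficients (\<open>J1_has_derivative\<close>, \<open>J2_has_derivative\<close>). In each
  component of the cross product \<open>E E'\<close> cancels, and \<open>E K'\<close>, \<open>E' K\<close>, \<open>K K'\<close> occur exactly in the
  proportion of Legendre's relation, so that a rational function remains
  (\<open>nabla_J_cross_products\<close>).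

  The brackets themselves contain \<open>I\<^sub>1 = 1 / (\<lambda> J\<^sub>1)\<close>, whose gradient is
  \<open>- \<nabla>J\<^sub>1 / (\<lambda> J\<^sub>1\<^sup>2)\<close>; the factor is cancelled by \<open>\<Xi>\<^sup>-\<^sup>1\<close>, and the sign by the order
  \<open>I\<^sub>2, I\<^sub>1\<close> of the last two arguments. Both \<open>J\<^sub>1\<close> and \<open>J\<^sub>2\<close> are constant along motions because
  their gradients annihilate the vector field, the coefficients of \<open>K\<close> and of \<open>E\<close> vanishing
  separately. Finally \<open>\<omega> = \<partial>\<^sub>x \<and> W\<close> with \<open>W = x\<^sup>3 (y\<^sup>2 - z\<^sup>2)\<^sup>-\<^sup>1 (V\<^sub>y \<partial>\<^sub>y + V\<^sub>z \<partial>\<^sub>z + V\<^sub>u \<partial>\<^sub>u)\<close>; as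
  \<open>W\<close> is homogeneous in \<open>x\<close>, its Lie derivative along \<open>\<partial>\<^sub>x\<close> is a multiple of \<open>W\<close>, which gives the
  Jacobi identity (\<open>poisson_tensor_wedge\<close>).

  The elliptic integrals are handled in trigonometric form and in the parameter \<open>m = k\<^sup>2\<close>. The
  singular endpoints then disappear, and the complementary integrals are the same two functions
  at \<open>1 - m\<close>.
\<close>

section \<open>Trigonometric form of the elliptic integrals\<close>

definition legendre_K :: "real \<Rightarrow> real" where
  "legendre_K m = integral {0..pi/2} (\<lambda>t. 1 / sqrt (1 - m * (sin t)\<^sup>2))"

definition legendre_E :: "real \<Rightarrow> real" where
  "legendre_E m = integral {0..pi/2} (\<lambda>t. sqrt (1 - m * (sin t)\<^sup>2))"

lemma one_minus_m_sin2_pos: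
  fixes m t :: real
  assumes "m < 1"
  shows "0 < 1 - m * (sin t)\<^sup>2"
proof (cases "m \<le> 0")
  case True
  then have "m * (sin t)\<^sup>2 \<le> 0" by (simp add: mult_nonpos_nonneg)
  then show ?thesis by simp
next
  case False
  have "(sin t)\<^sup>2 \<le> 1" by (simp add: abs_square_le_1)
  then have "m * (sin t)\<^sup>2 \<le> m * 1" using False by (intro mult_left_mono) auto
  then show ?thesis using assms by simp
qed

lemma continuous_on_legendre_K_integrand:
  assumes "m < 1"
  shows "continuous_on S (\<lambda>t. 1 / sqrt (1 - m * (sin t)\<^sup>2))"
proof (intro continuous_intros ballI)
  show "sqrt (1 - m * (sin t)\<^sup>2) \<noteq> 0" for t
    using one_minus_m_sin2_pos[OF assms, of t] by simp
qed

text \<open>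
  The substitution rule needs the derivative of \<open>arcsin\<close> only off a finite set, so the
  singular endpoint \<open>s = 1\<close> costs nothing beyond continuity there.
\<close>

lemma integral_arcsin_substitution:
  fixes f :: "real \<Rightarrow> real"
  assumes "continuous_on {0..pi/2} f"
  shows "integral {0..1} (\<lambda>s. f (arcsin s) / sqrt (1 - s\<^sup>2)) = integral {0..pi/2} f"
proof -
  have "((\<lambda>s. (1 / sqrt (1 - s\<^sup>2)) *\<^sub>R f (arcsin s)) has_integral
          (integral {arcsin 0..arcsin 1} f - integral {arcsin 1..arcsin 0} f)) {0..1}"
  proof (rule has_integral_substitution_general[where s = "{1}" and c = 0 and d = "pi/2"])
    show "arcsin ` {0..1} \<subseteq> {0..pi/2}"
      using arcsin_le_arcsin[of 0] arcsin_ubound by fastforce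
    show "continuous_on {0..1} arcsin"
      by (intro continuous_on_arcsin continuous_intros) auto
    show "(arcsin has_real_derivative 1 / sqrt (1 - s\<^sup>2)) (at s within {0..1})"
      if "s \<in> {0..1} - {1}" for s
      using DERIV_arcsin[of s] that
      by (auto intro: has_field_derivative_at_within simp: divide_inverse)
  qed (use assms in auto)
  then show ?thesis
    by (simp add: integral_unique)
qed

lemma legendre_K_algebraic:
  assumes "m < 1"
  shows "integral {0..1} (\<lambda>s. 1 / sqrt ((1 - s\<^sup>2) * (1 - m * s\<^sup>2))) = legendre_K m"
proof -
  have "integral {0..1} (\<lambda>s. 1 / sqrt ((1 - s\<^sup>2) * (1 - m * s\<^sup>2))) =
        integral {0..1} (\<lambda>s. (1 / sqrt (1 - m * (sin (arcsin s))\<^sup>2)) / sqrt (1 - s\<^sup>2))"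
    by (intro integral_cong) (simp add: real_sqrt_mult)
  also have "\<dots> = legendre_K m"
    unfolding legendre_K_def
    by (intro integral_arcsin_substitution continuous_on_legendre_K_integrand assms)
  finally show ?thesis .
qed

lemma legendre_E_algebraic:
  "integral {0..1} (\<lambda>s. sqrt ((1 - m * s\<^sup>2) / (1 - s\<^sup>2))) = legendre_E m"
proof -
  have "integral {0..1} (\<lambda>s. sqrt ((1 - m * s\<^sup>2) / (1 - s\<^sup>2))) =
        integral {0..1} (\<lambda>s. sqrt (1 - m * (sin (arcsin s))\<^sup>2) / sqrt (1 - s\<^sup>2))"
    by (intro integral_cong) (simp add: real_sqrt_divide)
  also have "\<dots> = legendre_E m"
    unfolding legendre_E_def
    by (rule integral_arcsin_substitution) (intro continuous_intros)
  finally show ?thesis .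
qed

lemma ell_K_eq: "0 < k \<Longrightarrow> k < 1 \<Longrightarrow> ell_K k = legendre_K (k\<^sup>2)"
  unfolding ell_K_def by (rule legendre_K_algebraic) (simp add: abs_square_less_1)

lemma ell_E_eq: "ell_E k = legendre_E (k\<^sup>2)"
  unfolding ell_E_def by (rule legendre_E_algebraic)

lemma ell_E'_eq: "ell_E' k = legendre_E (1 - k\<^sup>2)"
  unfolding ell_E'_def by (rule legendre_E_algebraic)

text \<open>
  The substitution \<open>s\<^sup>2 = 1 - (1 - k\<^sup>2) sin\<^sup>2 t\<close> turns \<open>s\<close> from \<open>k\<close> to \<open>1\<close> into \<open>t\<close> from \<open>\<pi>/2\<close> to
  \<open>0\<close>. It cancels both singular factors, and the remaining integrand is that of \<open>K\<close> with
  the complementary parameter.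
\<close>

lemma ell_K'_eq:
  assumes k: "0 < k" "k < 1"
  shows "ell_K' k = legendre_K (1 - k\<^sup>2)"
proof -
  define q where "q = 1 - k\<^sup>2"
  define w where "w s = sqrt ((1 - s\<^sup>2) / q)" for s
  define f where "f t = 1 / sqrt (1 - q * (sin t)\<^sup>2)" for t
  have q: "0 < q" "q < 1" using k by (simp_all add: q_def abs_square_less_1)
  have w_range: "0 \<le> w s" "w s \<le> 1" if "s \<in> {k..1}" for s
  proof -
    have "k\<^sup>2 \<le> s\<^sup>2" "s\<^sup>2 \<le> 1"
      using that k by (auto intro: power_mono simp: abs_square_le_1)
    then show "0 \<le> w s" "w s \<le> 1"
      using q by (simp_all add: w_def q_def)
  qed
  have "((\<lambda>s. (- s / sqrt ((1 - s\<^sup>2) * (s\<^sup>2 - k\<^sup>2))) *\<^sub>R f (arcsin (w s))) has_integral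
          (integral {arcsin (w k)..arcsin (w 1)} f - integral {arcsin (w 1)..arcsin (w k)} f)) {k..1}"
  proof (rule has_integral_substitution_general[where s = "{k, 1}" and c = 0 and d = "pi/2"])
    show "(\<lambda>s. arcsin (w s)) ` {k..1} \<subseteq> {0..pi/2}"
      using w_range arcsin_le_arcsin[of 0] arcsin_ubound by fastforce
    show "continuous_on {0..pi/2} f"
      unfolding f_def by (intro continuous_on_legendre_K_integrand q)
    show "continuous_on {k..1} (\<lambda>s. arcsin (w s))"
    proof (intro continuous_on_arcsin ballI)
      show "continuous_on {k..1} w" unfolding w_def using q by (intro continuous_intros) auto
    qed (use w_range in \<open>force+\<close>)
    show "((\<lambda>s. arcsin (w s)) has_real_derivative - s / sqrt ((1 - s\<^sup>2) * (s\<^sup>2 - k\<^sup>2)))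
            (at s within {k..1})" if "s \<in> {k..1} - {k, 1}" for s
    proof -
      have s: "k < s" "s < 1" using that by auto
      have s2: "k\<^sup>2 < s\<^sup>2" "s\<^sup>2 < 1"
        using s k by (auto intro: power_strict_mono simp: abs_square_less_1)
      define p where "p = (1 - s\<^sup>2) / q"
      have p: "0 < p" "p < 1" using s2 q by (simp_all add: p_def q_def)
      have sp: "0 < sqrt p" "sqrt p < 1" using p by simp_all
      have dp: "((\<lambda>s. (1 - s\<^sup>2) / q) has_real_derivative - (2 * s) / q) (at s)"
        using q by (auto intro!: derivative_eq_intros)
      have dw: "(w has_real_derivative inverse (sqrt p) / 2 * (- (2 * s) / q)) (at s)"
        unfolding w_def using DERIV_chain2[OF DERIV_real_sqrt dp] p by (simp add: p_def)
      have "w s = sqrt p" by (simp add: w_def p_def)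
      then have "((\<lambda>s. arcsin (w s)) has_real_derivative
              inverse (sqrt (1 - (sqrt p)\<^sup>2)) * (inverse (sqrt p) / 2 * (- (2 * s) / q))) (at s)"
        using DERIV_chain2[OF DERIV_arcsin dw] sp by simp
      also have "inverse (sqrt (1 - (sqrt p)\<^sup>2)) * (inverse (sqrt p) / 2 * (- (2 * s) / q))
          = - s / (q * sqrt (p * (1 - p)))"
        using p q unfolding real_sqrt_mult by (simp add: divide_simps)
      also have "q * sqrt (p * (1 - p)) = sqrt ((q * p) * (q * (1 - p)))"
      proof -
        have "(q * p) * (q * (1 - p)) = q\<^sup>2 * (p * (1 - p))" by (simp add: power2_eq_square)
        then show ?thesis using q by (simp add: real_sqrt_mult)
      qed
      also have "(q * p) * (q * (1 - p)) = (1 - s\<^sup>2) * (s\<^sup>2 - k\<^sup>2)"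
      proof -
        have "q * p = 1 - s\<^sup>2" using q by (simp add: p_def)
        moreover have "q * (1 - p) = s\<^sup>2 - k\<^sup>2"
          using \<open>q * p = _\<close> by (simp add: right_diff_distrib q_def)
        ultimately show ?thesis by simp
      qed
      finally show ?thesis by (rule has_field_derivative_at_within)
    qed
  qed (use k in auto)
  moreover have "w k = 1" "w 1 = 0" using q by (simp_all add: w_def q_def)
  ultimately have *: "((\<lambda>s. (- s / sqrt ((1 - s\<^sup>2) * (s\<^sup>2 - k\<^sup>2))) *\<^sub>R f (arcsin (w s)))
      has_integral - integral {0..pi/2} f) {k..1}"
    by simp
  have "integral {k..1} (\<lambda>s. 1 / sqrt ((1 - s\<^sup>2) * (s\<^sup>2 - k\<^sup>2))) =
      integral {k..1} (\<lambda>s. - ((- s / sqrt ((1 - s\<^sup>2) * (s\<^sup>2 - k\<^sup>2))) *\<^sub>R f (arcsin (w s))))"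
  proof (rule integral_cong)
    fix s assume s: "s \<in> {k..1}"
    have "s\<^sup>2 \<le> 1" using s k by (simp add: abs_square_le_1)
    then have "q * (w s)\<^sup>2 = 1 - s\<^sup>2" using q by (simp add: w_def)
    moreover have "sin (arcsin (w s)) = w s" using w_range[OF s] by simp
    ultimately have "f (arcsin (w s)) = 1 / s" using s k by (simp add: f_def)
    then show "1 / sqrt ((1 - s\<^sup>2) * (s\<^sup>2 - k\<^sup>2)) =
        - ((- s / sqrt ((1 - s\<^sup>2) * (s\<^sup>2 - k\<^sup>2))) *\<^sub>R f (arcsin (w s)))"
      using s k by simp
  qed
  also have "\<dots> = integral {0..pi/2} f"
    using has_integral_neg[OF *] by (simp add: integral_unique)
  finally show ?thesis
    by (simp add: ell_K'_def legendre_K_def f_def[abs_def] q_def)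
qed

section \<open>Derivatives in the parameter\<close>

lemma legendre_K_has_derivative_integral:
  assumes "m < 1"
  shows "(legendre_K has_real_derivative
      integral {0..pi/2} (\<lambda>t. (sin t)\<^sup>2 / (2 * sqrt (1 - m * (sin t)\<^sup>2) ^ 3))) (at m)"
proof -
  have "((\<lambda>m. integral (cbox 0 (pi/2)) (\<lambda>t. 1 / sqrt (1 - m * (sin t)\<^sup>2))) has_real_derivative
      integral (cbox 0 (pi/2)) (\<lambda>t. (sin t)\<^sup>2 / (2 * sqrt (1 - m * (sin t)\<^sup>2) ^ 3)))
      (at m within {..<1})"
  proof (rule leibniz_rule_field_derivative)
    fix m t :: real
    assume "m \<in> {..<1}"
    then have *: "0 < 1 - m * (sin t)\<^sup>2" using one_minus_m_sin2_pos by simp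
    define r where "r = sqrt (1 - m * (sin t)\<^sup>2)"
    have r: "r > 0" using * by (simp add: r_def)
    have "((\<lambda>m. sqrt (1 - m * (sin t)\<^sup>2)) has_real_derivative inverse r / 2 * (- ((sin t)\<^sup>2))) (at m)"
      unfolding r_def by (rule derivative_eq_intros refl | use * in simp)+
    from DERIV_inverse'[OF this]
    have "((\<lambda>m. inverse (sqrt (1 - m * (sin t)\<^sup>2))) has_real_derivative
        - (inverse r * (inverse r / 2 * (- ((sin t)\<^sup>2))) * inverse r)) (at m)"
      using r by (simp add: r_def)
    also have "- (inverse r * (inverse r / 2 * (- ((sin t)\<^sup>2))) * inverse r) = (sin t)\<^sup>2 / (2 * r ^ 3)"
      using r by (simp add: divide_simps power3_eq_cube)
    also have "r = sqrt (1 - m * (sin t)\<^sup>2)" by (fact r_def)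
    finally show "((\<lambda>m. 1 / sqrt (1 - m * (sin t)\<^sup>2)) has_real_derivative
        (sin t)\<^sup>2 / (2 * sqrt (1 - m * (sin t)\<^sup>2) ^ 3)) (at m within {..<1})"
      unfolding inverse_eq_divide by (rule has_field_derivative_at_within)
  next
    fix m :: real assume "m \<in> {..<1}"
    then show "(\<lambda>t. 1 / sqrt (1 - m * (sin t)\<^sup>2)) integrable_on cbox 0 (pi/2)"
      by (intro integrable_continuous continuous_on_legendre_K_integrand) simp
  next
    have "sqrt (1 - fst p * (sin (snd p))\<^sup>2) \<noteq> 0" if "p \<in> {..<1} \<times> cbox 0 (pi/2)" for p :: "real \<times> real"
      using that one_minus_m_sin2_pos[of "fst p" "snd p"] by auto
    then show "continuous_on ({..<1} \<times> cbox 0 (pi/2)) (\<lambda>(m, t). (sin t)\<^sup>2 / (2 * sqrt (1 - m * (sin t)\<^sup>2) ^ 3))"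
      unfolding split_beta by (intro continuous_intros) auto
  qed (use assms in auto)
  then show ?thesis
    using assms by (simp add: legendre_K_def[abs_def] at_within_open[of _ "{..<1}"])
qed

lemma legendre_E_has_derivative_integral:
  assumes "m < 1"
  shows "(legendre_E has_real_derivative
      integral {0..pi/2} (\<lambda>t. - (sin t)\<^sup>2 / (2 * sqrt (1 - m * (sin t)\<^sup>2)))) (at m)"
proof -
  have "((\<lambda>m. integral (cbox 0 (pi/2)) (\<lambda>t. sqrt (1 - m * (sin t)\<^sup>2))) has_real_derivative
      integral (cbox 0 (pi/2)) (\<lambda>t. - (sin t)\<^sup>2 / (2 * sqrt (1 - m * (sin t)\<^sup>2))))
      (at m within {..<1})"
  proof (rule leibniz_rule_field_derivative)
    fix m t :: real
    assume "m \<in> {..<1}"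
    then have *: "0 < 1 - m * (sin t)\<^sup>2" using one_minus_m_sin2_pos by simp
    have "((\<lambda>m. sqrt (1 - m * (sin t)\<^sup>2)) has_real_derivative
        inverse (sqrt (1 - m * (sin t)\<^sup>2)) / 2 * (- ((sin t)\<^sup>2))) (at m)"
      by (rule derivative_eq_intros refl | use * in simp)+
    also have "inverse (sqrt (1 - m * (sin t)\<^sup>2)) / 2 * (- ((sin t)\<^sup>2)) =
        - (sin t)\<^sup>2 / (2 * sqrt (1 - m * (sin t)\<^sup>2))"
      by (simp add: inverse_eq_divide)
    finally show "((\<lambda>m. sqrt (1 - m * (sin t)\<^sup>2)) has_real_derivative
        - (sin t)\<^sup>2 / (2 * sqrt (1 - m * (sin t)\<^sup>2))) (at m within {..<1})"
      by (rule has_field_derivative_at_within)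
  next
    fix m :: real
    show "(\<lambda>t. sqrt (1 - m * (sin t)\<^sup>2)) integrable_on cbox 0 (pi/2)"
      by (intro integrable_continuous continuous_intros)
  next
    have "sqrt (1 - fst p * (sin (snd p))\<^sup>2) \<noteq> 0" if "p \<in> {..<1} \<times> cbox 0 (pi/2)" for p :: "real \<times> real"
      using that one_minus_m_sin2_pos[of "fst p" "snd p"] by auto
    then show "continuous_on ({..<1} \<times> cbox 0 (pi/2)) (\<lambda>(m, t). - (sin t)\<^sup>2 / (2 * sqrt (1 - m * (sin t)\<^sup>2)))"
      unfolding split_beta by (intro continuous_intros) auto
  qed (use assms in auto)
  then show ?thesis
    using assms by (simp add: legendre_E_def[abs_def] at_within_open[of _ "{..<1}"])
qed

lemma legendre_K_has_integral:
  "m < 1 \<Longrightarrow> ((\<lambda>t. 1 / sqrt (1 - m * (sin t)\<^sup>2)) has_integral legendre_K m) {0..pi/2}"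
  unfolding legendre_K_def
  by (intro integrable_integral integrable_continuous_real continuous_on_legendre_K_integrand)

lemma legendre_E_has_integral:
  "((\<lambda>t. sqrt (1 - m * (sin t)\<^sup>2)) has_integral legendre_E m) {0..pi/2}"
  unfolding legendre_E_def
  by (intro integrable_integral integrable_continuous_real continuous_intros)

lemma DERIV_legendre_E:
  assumes "m < 1" "m \<noteq> 0"
  shows "(legendre_E has_real_derivative (legendre_E m - legendre_K m) / (2 * m)) (at m)"
proof -
  have "((\<lambda>t. (sqrt (1 - m * (sin t)\<^sup>2) - 1 / sqrt (1 - m * (sin t)\<^sup>2)) / (2 * m)) has_integral
      (legendre_E m - legendre_K m) / (2 * m)) {0..pi/2}"
    by (intro has_integral_divide has_integral_diff legendre_E_has_integral
        legendre_K_has_integral assms)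
  also have "(\<lambda>t. (sqrt (1 - m * (sin t)\<^sup>2) - 1 / sqrt (1 - m * (sin t)\<^sup>2)) / (2 * m)) =
      (\<lambda>t. - (sin t)\<^sup>2 / (2 * sqrt (1 - m * (sin t)\<^sup>2)))"
  proof
    fix t :: real
    define r where "r = sqrt (1 - m * (sin t)\<^sup>2)"
    have r: "r > 0" "r * r = 1 - m * (sin t)\<^sup>2"
      using one_minus_m_sin2_pos[OF assms(1), of t] by (simp_all add: r_def)
    then have "(r - 1 / r) / (2 * m) = (r * r - 1) / (2 * m * r)"
      using assms by (simp add: field_simps)
    also have "\<dots> = - (sin t)\<^sup>2 / (2 * r)" unfolding r(2) using r assms by (simp add: field_simps)
    finally show "(sqrt (1 - m * (sin t)\<^sup>2) - 1 / sqrt (1 - m * (sin t)\<^sup>2)) / (2 * m) =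
      - (sin t)\<^sup>2 / (2 * sqrt (1 - m * (sin t)\<^sup>2))" unfolding r_def .
  qed
  finally have "integral {0..pi/2} (\<lambda>t. - (sin t)\<^sup>2 / (2 * sqrt (1 - m * (sin t)\<^sup>2))) =
      (legendre_E m - legendre_K m) / (2 * m)"
    by (rule integral_unique)
  then show ?thesis
    using legendre_E_has_derivative_integral[OF assms(1)] by (simp only:)
qed

text \<open>
  The difference between the integral obtained under the integral sign and the right-hand
  side is a multiple of \<open>\<integral> d/dt (sin t cos t / sqrt (1 - m sin\<^sup>2 t)) dt\<close> over \<open>[0, \<pi>/2]\<close>, and the
  primitive vanishes at both ends.
\<close>

lemma DERIV_legendre_K:
  assumes "m < 1" "m \<noteq> 0"
  shows "(legendre_K has_real_derivative
      (legendre_E m - (1 - m) * legendre_K m) / (2 * m * (1 - m))) (at m)"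
proof -
  define r where "r t = sqrt (1 - m * (sin t)\<^sup>2)" for t
  have r: "r t > 0" "r t * r t = 1 - m * (sin t)\<^sup>2" for t
    using one_minus_m_sin2_pos[OF assms(1), of t] by (simp_all add: r_def)
  \<comment> \<open>the derivative of \<open>sin t cos t / r t\<close>\<close>
  define B where "B t = ((cos t)\<^sup>2 - (sin t)\<^sup>2) / r t + m * (sin t)\<^sup>2 * (cos t)\<^sup>2 / r t ^ 3" for t
  have "((\<lambda>t. sin t * cos t / r t) has_real_derivative B t) (at t)" for t
  proof -
    have "((\<lambda>t. 1 - m * (sin t)\<^sup>2) has_real_derivative - (2 * m * sin t * cos t)) (at t)"
      by (auto intro!: derivative_eq_intros)
    from DERIV_chain2[OF DERIV_real_sqrt this]
    have "(r has_real_derivative inverse (r t) / 2 * - (2 * m * sin t * cos t)) (at t)"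
      using one_minus_m_sin2_pos[OF assms(1), of t] by (simp add: r_def[abs_def])
    also have "inverse (r t) / 2 * - (2 * m * sin t * cos t) = - (m * sin t * cos t) / r t"
      by (simp add: inverse_eq_divide)
    finally have "((\<lambda>t. sin t * cos t / r t) has_real_derivative
        ((cos t * cos t + sin t * - sin t) * r t - sin t * cos t * (- (m * sin t * cos t) / r t))
          / (r t * r t)) (at t)"
      using r(1)[of t] by (auto intro!: derivative_eq_intros)
    also have "((cos t * cos t + sin t * - sin t) * r t - sin t * cos t * (- (m * sin t * cos t) / r t))
          / (r t * r t) = B t"
      using r(1)[of t] by (simp add: B_def divide_simps power2_eq_square power3_eq_cube)
    finally show ?thesis .
  qed
  then have "(B has_integral sin (pi/2) * cos (pi/2) / r (pi/2) - sin 0 * cos 0 / r 0) {0..pi/2}"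
    by (intro fundamental_theorem_of_calculus)
      (auto simp: has_real_derivative_iff_has_vector_derivative[symmetric]
            intro: has_field_derivative_at_within)
  then have "(B has_integral 0) {0..pi/2}" by simp
  then have "((\<lambda>t. (r t - (1 - m) * (1 / r t) - m * B t) / (2 * m * (1 - m))) has_integral
      (legendre_E m - (1 - m) * legendre_K m - m * 0) / (2 * m * (1 - m))) {0..pi/2}"
    using legendre_K_has_integral[OF assms(1)] legendre_E_has_integral[of m]
    by (intro has_integral_divide has_integral_diff has_integral_mult_right) (simp_all add: r_def)
  also have "(\<lambda>t. (r t - (1 - m) * (1 / r t) - m * B t) / (2 * m * (1 - m))) =
      (\<lambda>t. (sin t)\<^sup>2 / (2 * r t ^ 3))"
  proof
    fix t :: real
    define S where "S = (sin t)\<^sup>2"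
    have c: "(cos t)\<^sup>2 = 1 - S" unfolding S_def by (rule cos_squared_eq)
    have Bt: "B t = ((1 - 2 * S) * (r t * r t) + m * S * (1 - S)) / r t ^ 3"
      unfolding B_def c S_def[symmetric] using r(1)[of t]
      by (simp add: divide_simps power3_eq_cube)
    have "r t - (1 - m) * (1 / r t) - m * B t =
        ((r t * r t)\<^sup>2 - (1 - m) * (r t * r t) - m * ((1 - 2 * S) * (r t * r t) + m * S * (1 - S))) / r t ^ 3"
      unfolding Bt using r(1)[of t]
      by (simp add: divide_simps power2_eq_square power3_eq_cube) (simp add: algebra_simps)
    also have "\<dots> = (m * (1 - m) * S) / r t ^ 3"
      unfolding r(2) S_def[symmetric] by (simp add: algebra_simps power2_eq_square)
    finally show "(r t - (1 - m) * (1 / r t) - m * B t) / (2 * m * (1 - m)) = (sin t)\<^sup>2 / (2 * r t ^ 3)"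
      using assms r(1)[of t] by (simp add: S_def field_simps)
  qed
  finally have "integral {0..pi/2} (\<lambda>t. (sin t)\<^sup>2 / (2 * sqrt (1 - m * (sin t)\<^sup>2) ^ 3)) =
      (legendre_E m - (1 - m) * legendre_K m) / (2 * m * (1 - m))"
    unfolding r_def by (simp only: integral_unique mult_zero_right diff_zero)
  then show ?thesis
    using legendre_K_has_derivative_integral[OF assms(1)] by (simp only:)
qed

section \<open>Legendre's relation\<close>

lemma legendre_K_0: "legendre_K 0 = pi / 2"
  by (simp add: legendre_K_def)

lemma legendre_E_0: "legendre_E 0 = pi / 2"
  by (simp add: legendre_E_def)

lemma legendre_E_1: "legendre_E 1 = 1"
proof -
  have "(cos has_integral sin (pi/2) - sin 0) {0..pi/2}"
    by (intro fundamental_theorem_of_calculus)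
      (auto simp: has_real_derivative_iff_has_vector_derivative[symmetric] intro!: derivative_eq_intros)
  moreover have "legendre_E 1 = integral {0..pi/2} cos"
    unfolding legendre_E_def
    by (intro integral_cong) (auto simp: cos_squared_eq[symmetric] cos_ge_zero)
  ultimately show ?thesis by (simp add: integral_unique)
qed

lemma continuous_on_legendre_E: "continuous_on UNIV legendre_E"
proof -
  have "continuous_on UNIV (\<lambda>m. integral (cbox 0 (pi/2)) (\<lambda>t. sqrt (1 - m * (sin t)\<^sup>2)))"
    by (rule integral_continuous_on_param) (auto simp: split_beta intro!: continuous_intros)
  then show ?thesis by (simp add: legendre_E_def[abs_def])
qed

text \<open>
  The upper bound controls the growth of \<open>K'\<close> at \<open>m = 0\<close>: it is at most of order \<open>m\<close> to the
  power \<open>-1/2\<close>, which is weaker than the logarithmic truth but beats the zero of \<open>E - K\<close>.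
\<close>

lemma legendre_K_bounds:
  assumes "0 \<le> m" "m < 1"
  shows "0 \<le> legendre_K m" "legendre_K m \<le> pi / 2 / sqrt (1 - m)"
proof -
  show "0 \<le> legendre_K m"
    using legendre_K_has_integral[OF assms(2)]
    by (rule has_integral_nonneg) (use one_minus_m_sin2_pos[OF assms(2)] in \<open>simp add: less_imp_le\<close>)
  have "((\<lambda>t. 1 / sqrt (1 - m)) has_integral (pi / 2) * (1 / sqrt (1 - m))) {0..pi/2}"
    using has_integral_const_real[of "1 / sqrt (1 - m)" 0 "pi/2"] by simp
  then have "legendre_K m \<le> (pi / 2) * (1 / sqrt (1 - m))"
  proof (rule has_integral_le[OF legendre_K_has_integral[OF assms(2)]])
    fix t :: real
    have "m * (sin t)\<^sup>2 \<le> m * 1" using assms by (intro mult_left_mono) (simp_all add: abs_square_le_1)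
    then have "sqrt (1 - m) \<le> sqrt (1 - m * (sin t)\<^sup>2)" by simp
    moreover have "0 < sqrt (1 - m)" using assms by simp
    ultimately show "1 / sqrt (1 - m * (sin t)\<^sup>2) \<le> 1 / sqrt (1 - m)"
      by (simp add: frac_le)
  qed
  then show "legendre_K m \<le> pi / 2 / sqrt (1 - m)" by simp
qed

lemma DERIV_legendre_K_compl:
  assumes "0 < m" "m < 1"
  shows "((\<lambda>m. legendre_K (1 - m)) has_real_derivative
      - (legendre_E (1 - m) - m * legendre_K (1 - m)) / (2 * m * (1 - m))) (at m)"
proof -
  have "((\<lambda>m. 1 - m) has_real_derivative - 1) (at m)"
    by (auto intro!: derivative_eq_intros)
  moreover have "(legendre_K has_real_derivative
      (legendre_E (1 - m) - m * legendre_K (1 - m)) / (2 * m * (1 - m))) (at (1 - m))"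
    using DERIV_legendre_K[of "1 - m"] assms by (simp add: mult.commute mult.left_commute)
  ultimately have "((\<lambda>m. legendre_K (1 - m)) has_real_derivative
      (legendre_E (1 - m) - m * legendre_K (1 - m)) / (2 * m * (1 - m)) * - 1) (at m)"
    by (intro DERIV_chain2[where f = legendre_K and g = "\<lambda>m. 1 - m"])
  then show ?thesis
    by (simp only: mult_minus_right mult_1_right minus_divide_left)
qed

lemma DERIV_legendre_E_compl:
  assumes "0 < m" "m < 1"
  shows "((\<lambda>m. legendre_E (1 - m)) has_real_derivative
      - (legendre_E (1 - m) - legendre_K (1 - m)) / (2 * (1 - m))) (at m)"
proof -
  have "((\<lambda>m. 1 - m) has_real_derivative - 1) (at m)"
    by (auto intro!: derivative_eq_intros)
  moreover have "(legendre_E has_real_derivative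
      (legendre_E (1 - m) - legendre_K (1 - m)) / (2 * (1 - m))) (at (1 - m))"
    using DERIV_legendre_E[of "1 - m"] assms by simp
  ultimately have "((\<lambda>m. legendre_E (1 - m)) has_real_derivative
      (legendre_E (1 - m) - legendre_K (1 - m)) / (2 * (1 - m)) * - 1) (at m)"
    by (intro DERIV_chain2[where f = legendre_E and g = "\<lambda>m. 1 - m"])
  then show ?thesis
    by (simp only: mult_minus_right mult_1_right minus_divide_left)
qed

text \<open>
  The left-hand side has derivative zero in \<open>m\<close>, and its constant value is found as \<open>m\<close> tends
  to \<open>0\<close>. There \<open>E' K\<close> tends to \<open>1 * \<pi>/2\<close>, while \<open>(E - K) K'\<close> tends to \<open>0\<close>: the first factor is
  of order \<open>m\<close>, which outweighs the divergence of \<open>K'\<close>.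
\<close>

lemma legendre_relation:
  assumes "0 < m" "m < 1"
  shows "legendre_E m * legendre_K (1 - m) + legendre_E (1 - m) * legendre_K m
      - legendre_K m * legendre_K (1 - m) = pi / 2"
proof -
  define L where "L m = legendre_E m * legendre_K (1 - m) + legendre_E (1 - m) * legendre_K m
      - legendre_K m * legendre_K (1 - m)" for m
  have "(L has_real_derivative 0) (at m)" if "0 < m" "m < 1" for m
  proof -
    define K E K' E' where "K = legendre_K m" and "E = legendre_E m"
      and "K' = legendre_K (1 - m)" and "E' = legendre_E (1 - m)"
    note defs = K_def E_def K'_def E'_def
    define n where "n = 1 - m"
    have nz: "m \<noteq> 0" "n \<noteq> 0" using that by (simp_all add: n_def)
    have dK: "(legendre_K has_real_derivative (E - n * K) / (2 * m * n)) (at m)"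
      unfolding defs n_def using that by (intro DERIV_legendre_K) auto
    have dE: "(legendre_E has_real_derivative (E - K) / (2 * m)) (at m)"
      unfolding defs using that by (intro DERIV_legendre_E) auto
    have dK': "((\<lambda>m. legendre_K (1 - m)) has_real_derivative - (E' - m * K') / (2 * m * n)) (at m)"
      unfolding defs n_def using that by (intro DERIV_legendre_K_compl)
    have dE': "((\<lambda>m. legendre_E (1 - m)) has_real_derivative - (E' - K') / (2 * n)) (at m)"
      unfolding defs n_def using that by (intro DERIV_legendre_E_compl)
    have "(L has_real_derivative
       ((E - K) / (2 * m)) * K' + (- (E' - m * K') / (2 * m * n)) * E
       + ((- (E' - K') / (2 * n)) * K + ((E - n * K) / (2 * m * n)) * E')
       - (((E - n * K) / (2 * m * n)) * K' + (- (E' - m * K') / (2 * m * n)) * K)) (at m)"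
      unfolding L_def defs
      by (intro DERIV_diff DERIV_add DERIV_mult dK[unfolded defs] dE[unfolded defs]
          dK'[unfolded defs] dE'[unfolded defs])
    moreover have "((E - K) / (2 * m)) * K' + (- (E' - m * K') / (2 * m * n)) * E
       + ((- (E' - K') / (2 * n)) * K + ((E - n * K) / (2 * m * n)) * E')
       - (((E - n * K) / (2 * m * n)) * K' + (- (E' - m * K') / (2 * m * n)) * K) =
       ((n + m - 1) * (E * K' - K * E') ) / (2 * m * n)"
      using nz by (simp add: divide_simps) (simp add: algebra_simps)
    ultimately show ?thesis by (simp add: n_def)
  qed
  then have "\<exists>c. \<forall>m\<in>{0<..<1}. L m = c"
    by (intro has_field_derivative_zero_constant) (auto intro: has_field_derivative_at_within)
  then obtain c where c: "L m = c" if "0 < m" "m < 1" for m by auto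
  have "(L \<longlongrightarrow> pi / 2) (at_right 0)"
  proof -
    have K: "(legendre_K \<longlongrightarrow> pi / 2) (at_right 0)"
      using DERIV_isCont[OF legendre_K_has_derivative_integral[of 0]]
      by (auto simp: isCont_def legendre_K_0 intro: filterlim_mono at_le)
    have E': "((\<lambda>m. legendre_E (1 - m)) \<longlongrightarrow> 1) (at_right 0)"
    proof -
      have "continuous_on UNIV (\<lambda>m. legendre_E (1 - m))"
        by (rule continuous_on_compose2[OF continuous_on_legendre_E]) (auto intro: continuous_intros)
      then have "((\<lambda>m. legendre_E (1 - m)) \<longlongrightarrow> legendre_E (1 - 0)) (at 0)"
        unfolding continuous_on_def by blast
      then show ?thesis
        by (auto simp: legendre_E_1 intro: filterlim_mono at_le)
    qed
    \<comment> \<open>a difference quotient at \<open>0\<close>, because \<open>E\<close> and \<open>K\<close> agree there\<close>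
    define q where "q m = (legendre_E m - legendre_K m) / m" for m
    obtain D where D: "(q \<longlongrightarrow> D) (at_right 0)"
    proof -
      have "((\<lambda>m. legendre_E m - legendre_K m) has_real_derivative
         integral {0..pi/2} (\<lambda>t. - (sin t)\<^sup>2 / (2 * sqrt (1 - 0 * (sin t)\<^sup>2))) -
         integral {0..pi/2} (\<lambda>t. (sin t)\<^sup>2 / (2 * sqrt (1 - 0 * (sin t)\<^sup>2) ^ 3))) (at 0)"
        by (intro DERIV_diff legendre_E_has_derivative_integral legendre_K_has_derivative_integral) simp_all
      then have "(q \<longlongrightarrow> integral {0..pi/2} (\<lambda>t. - (sin t)\<^sup>2 / (2 * sqrt (1 - 0 * (sin t)\<^sup>2))) -
         integral {0..pi/2} (\<lambda>t. (sin t)\<^sup>2 / (2 * sqrt (1 - 0 * (sin t)\<^sup>2) ^ 3))) (at 0)"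
        unfolding DERIV_def q_def[abs_def] by (simp add: legendre_K_0 legendre_E_0)
      then show ?thesis
        using that by (auto intro: filterlim_mono at_le)
    qed
    have mK': "((\<lambda>m. m * legendre_K (1 - m)) \<longlongrightarrow> 0) (at_right 0)"
    proof (rule tendsto_sandwich[where f = "\<lambda>_. 0" and h = "\<lambda>m. pi / 2 * sqrt m"])
      have ev: "\<forall>\<^sub>F m :: real in at_right 0. 0 < m \<and> m < 1"
        by (auto simp: eventually_at_right[of 0 1] intro: exI[of _ 1])
      show "\<forall>\<^sub>F m in at_right 0. 0 \<le> m * legendre_K (1 - m)"
        using ev by eventually_elim (simp add: legendre_K_bounds)
      show "\<forall>\<^sub>F m in at_right 0. m * legendre_K (1 - m) \<le> pi / 2 * sqrt m"
        using ev
      proof eventually_elim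
        case (elim m)
        then have "m * legendre_K (1 - m) \<le> m * (pi / 2 / sqrt m)"
          using legendre_K_bounds(2)[of "1 - m"] by (intro mult_left_mono) auto
        also have "\<dots> = pi / 2 * sqrt m"
          using elim by (simp add: field_simps)
        finally show ?case .
      qed
      show "((\<lambda>m. pi / 2 * sqrt m) \<longlongrightarrow> 0) (at_right 0)"
        by (auto intro!: tendsto_eq_intros)
    qed simp
    have "((\<lambda>m. q m * (m * legendre_K (1 - m)) + legendre_E (1 - m) * legendre_K m)
        \<longlongrightarrow> D * 0 + 1 * (pi / 2)) (at_right 0)"
      by (intro tendsto_intros D mK' K E')
    moreover have "\<forall>\<^sub>F m in at_right 0.
        q m * (m * legendre_K (1 - m)) + legendre_E (1 - m) * legendre_K m = L m"
      using eventually_at_right_less[of 0]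
    proof eventually_elim
      case (elim m)
      then have "q m * m = legendre_E m - legendre_K m" by (simp add: q_def)
      then show ?case
        by (simp add: L_def left_diff_distrib flip: mult.assoc)
    qed
    ultimately show ?thesis
      using Lim_transform_eventually by fastforce
  qed
  moreover have "(L \<longlongrightarrow> c) (at_right 0)"
  proof (rule Lim_transform_eventually[OF tendsto_const])
    show "\<forall>\<^sub>F m in at_right 0. c = L m"
      using c by (auto simp: eventually_at_right[of 0 1] intro!: exI[of _ 1])
  qed
  ultimately have "c = pi / 2"
    by (intro tendsto_unique[of "at_right (0::real)" L c "pi / 2"]) auto
  then show ?thesis using c[OF assms] by (simp add: L_def)
qed

section \<open>Partial derivatives\<close>

lemma nabla_eq:
  assumes "(f has_derivative D) (at X)"
  shows "nabla j f X = D (axis j 1)"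
proof -
  have "((\<lambda>t. X + t *\<^sub>R axis j 1) has_derivative (\<lambda>t. t *\<^sub>R axis j 1)) (at 0)"
    by (auto intro!: derivative_eq_intros)
  then have "((\<lambda>t. f (X + t *\<^sub>R axis j 1)) has_derivative (\<lambda>t. D (t *\<^sub>R axis j 1))) (at 0)"
    by (rule has_derivative_compose) (use assms in simp)
  moreover have "D (t *\<^sub>R axis j 1) = D (axis j 1) * t" for t
    using linear_scale[OF has_derivative_linear[OF assms]] by simp
  ultimately have "((\<lambda>t. f (X + t *\<^sub>R axis j 1)) has_real_derivative D (axis j 1)) (at 0)"
    by (simp add: has_field_derivative_def)
  then show ?thesis
    unfolding nabla_def by (rule DERIV_imp_deriv)
qed

lemma nabla_coordinate: "nabla j (\<lambda>Y. Y $ i) X = (if j = i then 1 else 0)"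
  by (subst nabla_eq[of _ "\<lambda>h. h $ i"])
    (auto intro: bounded_linear_imp_has_derivative bounded_linear_vec_nth simp: axis_def)

lemma nabla_minus:
  assumes "f differentiable (at X)"
  shows "nabla j (\<lambda>Y. - f Y) X = - nabla j f X"
proof -
  obtain D where D: "(f has_derivative D) (at X)"
    using assms by (auto simp: differentiable_def)
  show ?thesis
    using nabla_eq[OF D] nabla_eq[OF has_derivative_minus[OF D]] by simp
qed

lemma nabla_const: "nabla j (\<lambda>Y. c) X = 0"
  using nabla_eq[OF has_derivative_const] by simp

lemma nabla_I1:
  assumes "lam \<noteq> 0" "J1 X \<noteq> 0" "J1 differentiable (at X)"
  shows "nabla j (I1 lam) X = - nabla j J1 X / (lam * (J1 X)\<^sup>2)"
proof -
  obtain D where D: "(J1 has_derivative D) (at X)"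
    using assms by (auto simp: differentiable_def)
  have "((\<lambda>Y. inverse (lam * J1 Y)) has_derivative
      (\<lambda>h. - (inverse (lam * J1 X) * (lam * D h) * inverse (lam * J1 X)))) (at X)"
    using assms by (intro Deriv.has_derivative_inverse has_derivative_mult_right D) auto
  from nabla_eq[OF this, of j] nabla_eq[OF D, of j] show ?thesis
    using assms by (simp add: I1_def[abs_def] field_simps power2_eq_square)
qed

section \<open>The Levi-Civita symbol\<close>

text \<open>
  Regarding the four indices as one map on positions makes the exchange of two indices a
  composition with a transposition.
\<close>

definition sign_or_zero :: "(4 \<Rightarrow> 4) \<Rightarrow> real" where
  "sign_or_zero q = (if q permutes UNIV then of_int (sign q) else 0)"

lemma levi_civita_eq_sign_or_zero:
  "levi_civita j k l n =
    sign_or_zero (\<lambda>i. if i = 1 then j else if i = 2 then k else if i = 3 then l else n)"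
  by (simp only: levi_civita_def sign_or_zero_def Let_def)

lemma sign_or_zero_comp_transpose:
  assumes "a \<noteq> b"
  shows "sign_or_zero (q \<circ> Transposition.transpose a b) = - sign_or_zero q"
proof -
  have t: "Transposition.transpose a b permutes UNIV" by (simp add: permutes_swap_id)
  have iff: "q \<circ> Transposition.transpose a b permutes UNIV \<longleftrightarrow> q permutes UNIV"
  proof
    assume "q \<circ> Transposition.transpose a b permutes UNIV"
    from permutes_compose[OF t this] show "q permutes UNIV"
      by (simp add: o_assoc[symmetric])
  qed (rule permutes_compose[OF t])
  show ?thesis
  proof (cases "q permutes UNIV")
    case True
    then have "permutation q" "permutation (Transposition.transpose a b)"
      using t by (auto simp: permutation_permutes intro: exI[of _ UNIV])
    then have "sign (q \<circ> Transposition.transpose a b) = - sign q"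
      using assms by (simp add: sign_compose sign_swap_id)
    then show ?thesis using iff True by (simp add: sign_or_zero_def)
  qed (simp add: iff sign_or_zero_def)
qed

lemma levi_civita_swap12: "levi_civita k j l n = - levi_civita j k l n"
proof -
  have eq: "(\<lambda>i::4. if i = 1 then k else if i = 2 then j else if i = 3 then l else n) =
      (\<lambda>i. if i = 1 then j else if i = 2 then k else if i = 3 then l else n) \<circ> Transposition.transpose 1 2"
    by (auto simp: fun_eq_iff transpose_def)
  show ?thesis
    unfolding levi_civita_eq_sign_or_zero eq by (rule sign_or_zero_comp_transpose) simp
qed

lemma levi_civita_swap23: "levi_civita j l k n = - levi_civita j k l n"
proof -
  have eq: "(\<lambda>i::4. if i = 1 then j else if i = 2 then l else if i = 3 then k else n) =
      (\<lambda>i. if i = 1 then j else if i = 2 then k else if i = 3 then l else n) \<circ> Transposition.transpose 2 3"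
    by (auto simp: fun_eq_iff transpose_def)
  show ?thesis
    unfolding levi_civita_eq_sign_or_zero eq by (rule sign_or_zero_comp_transpose) simp
qed

lemma levi_civita_swap34: "levi_civita j k n l = - levi_civita j k l n"
proof -
  have eq: "(\<lambda>i::4. if i = 1 then j else if i = 2 then k else if i = 3 then n else l) =
      (\<lambda>i. if i = 1 then j else if i = 2 then k else if i = 3 then l else n) \<circ> Transposition.transpose 3 4"
  proof
    fix i :: 4
    show "(if i = 1 then j else if i = 2 then k else if i = 3 then n else l) =
        ((\<lambda>i. if i = 1 then j else if i = 2 then k else if i = 3 then l else n) \<circ> Transposition.transpose 3 4) i"
      using exhaust_4[of i] by (auto simp: transpose_def)
  qed
  show ?thesis
    unfolding levi_civita_eq_sign_or_zero eq by (rule sign_or_zero_comp_transpose) simp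
qed

lemma levi_civita_repeated:
  "levi_civita j j l n = 0" "levi_civita j k j n = 0" "levi_civita j k l j = 0"
  "levi_civita j k k n = 0" "levi_civita j k l k = 0" "levi_civita j k l l = 0"
  using levi_civita_swap12 levi_civita_swap23 levi_civita_swap34
  by (smt (verit))+

text \<open>
  Each equation exchanges two adjacent indices that are in descending order. Used as rewrite
  rules they sort the indices, so they terminate and reduce every permutation to \<open>1 2 3 4\<close>.
\<close>

lemmas levi_civita_sort =
  levi_civita_swap12[of 2 1] levi_civita_swap12[of 3 1] levi_civita_swap12[of 3 2]
  levi_civita_swap12[of 4 1] levi_civita_swap12[of 4 2] levi_civita_swap12[of 4 3]
  levi_civita_swap23[where k = 1 and l = 2] levi_civita_swap23[where k = 1 and l = 3]
  levi_civita_swap23[where k = 2 and l = 3] levi_civita_swap23[where k = 1 and l = 4]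
  levi_civita_swap23[where k = 2 and l = 4] levi_civita_swap23[where k = 3 and l = 4]
  levi_civita_swap34[where l = 1 and n = 2] levi_civita_swap34[where l = 1 and n = 3]
  levi_civita_swap34[where l = 2 and n = 3] levi_civita_swap34[where l = 1 and n = 4]
  levi_civita_swap34[where l = 2 and n = 4] levi_civita_swap34[where l = 3 and n = 4]

text \<open>
  This is the Hodge dual of \<open>a \<and> b\<close> in dimension 4. The first row is the cross product in the
  coordinates 2, 3, 4, and the entries outside the first row and column vanish if
  \<open>a 1 = b 1 = 0\<close>.
\<close>

lemma levi_civita_contraction:
  fixes a b :: "4 \<Rightarrow> real"
  defines "S \<equiv> \<lambda>j k. \<Sum>l\<in>UNIV. \<Sum>n\<in>UNIV. levi_civita j k l n * a l * b n"
  shows "S 1 2 = a 3 * b 4 - a 4 * b 3"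
    and "S 1 3 = a 4 * b 2 - a 2 * b 4"
    and "S 1 4 = a 2 * b 3 - a 3 * b 2"
    and "S 2 3 = a 1 * b 4 - a 4 * b 1"
    and "S 2 4 = a 3 * b 1 - a 1 * b 3"
    and "S 3 4 = a 1 * b 2 - a 2 * b 1"
    and "S j j = 0"
    and "S k j = - S j k"
proof -
  show "S k j = - S j k"
    unfolding S_def levi_civita_swap12[of k j] by (simp add: sum_negf)
qed (simp_all add: S_def sum_4 levi_civita_repeated levi_civita_sort levi_civita_1234)

lemma levi_civita_contraction_swap:
  "(\<Sum>l\<in>UNIV. \<Sum>n\<in>UNIV. levi_civita j k l n * b l * a n) =
   - (\<Sum>l\<in>UNIV. \<Sum>n\<in>UNIV. levi_civita j k l n * a l * b n)"
proof -
  have "(\<Sum>l\<in>UNIV. \<Sum>n\<in>UNIV. levi_civita j k l n * b l * a n) =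
      (\<Sum>n\<in>UNIV. \<Sum>l\<in>UNIV. levi_civita j k l n * b l * a n)"
    by (rule sum.swap)
  also have "\<dots> = (\<Sum>n\<in>UNIV. \<Sum>l\<in>UNIV. - (levi_civita j k n l * a n * b l))"
  proof (intro sum.cong refl)
    fix l n
    show "levi_civita j k l n * b l * a n = - (levi_civita j k n l * a n * b l)"
      using levi_civita_swap34[of j k l n] by simp
  qed
  finally show ?thesis by (simp add: sum_negf)
qed

section \<open>Poisson tensors and integrals of motion\<close>

text \<open>
  With \<open>w = \<partial>\<^sub>1 \<and> W\<close>, the Jacobi identity for \<open>w\<close> amounts to \<open>W \<and> [\<partial>\<^sub>1, W] \<and> \<partial>\<^sub>1 = 0\<close>. It therefore
  suffices that the derivative of \<open>W\<close> along the first axis is proportional to \<open>W\<close>.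
\<close>

lemma poisson_tensor_wedge:
  fixes w :: "real^4 \<Rightarrow> real^4^4" and W :: "4 \<Rightarrow> real^4 \<Rightarrow> real"
  assumes w: "\<And>Y j k. w Y $ j $ k = (if j = 1 then W k Y else 0) - (if k = 1 then W j Y else 0)"
    and diff: "\<And>X k. X \<in> S \<Longrightarrow> W k differentiable (at X)"
    and W1: "\<And>Y. W 1 Y = 0"
    and scal: "\<And>X k. X \<in> S \<Longrightarrow> nabla 1 (W k) X = c X * W k X"
  shows "poisson_tensor_on S w"
  unfolding poisson_tensor_on_def
proof (intro ballI conjI allI)
  fix X assume X: "X \<in> S"
  have entry: "(\<lambda>Y. w Y $ j $ k) = (if j = 1 then if k = 1 then (\<lambda>Y. 0) else W k
      else if k = 1 then (\<lambda>Y. - W j Y) else (\<lambda>Y. 0))" for j k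
    by (auto simp: w W1)
  show "w differentiable (at X)"
    unfolding differentiable_componentwise_within[of w]
  proof
    fix b :: "real^4^4" assume "b \<in> Basis"
    then obtain i k where b: "b = axis i (axis k 1)"
      by (auto simp: Basis_vec_def)
    have "(\<lambda>Y. w Y \<bullet> b) = (\<lambda>Y. w Y $ i $ k)"
      by (simp add: b inner_axis)
    moreover have "(\<lambda>Y. w Y $ i $ k) differentiable (at X)"
      unfolding entry using diff[OF X] by auto
    ultimately show "(\<lambda>Y. w Y \<bullet> b) differentiable (at X)" by simp
  qed
  show "w X $ j $ k = - (w X $ k $ j)" for j k
    by (simp add: w)
  have nb: "nabla l (\<lambda>Y. w Y $ j $ k) X = (if j = 1 then nabla l (W k) X else 0)
      - (if k = 1 then nabla l (W j) X else 0)" for l j k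
    unfolding entry using diff[OF X] W1
    by (auto simp: nabla_minus nabla_const)
  have sumw: "(\<Sum>l\<in>UNIV. w X $ i $ l * f l) =
      (if i = 1 then \<Sum>l\<in>UNIV. W l X * f l else 0) - W i X * f 1" for i f
    by (auto simp: w sum_4 W1 algebra_simps)
  fix i j k
  show "(\<Sum>l\<in>UNIV.
             w X $ i $ l * nabla l (\<lambda>Y. w Y $ j $ k) X
           + w X $ j $ l * nabla l (\<lambda>Y. w Y $ k $ i) X
           + w X $ k $ l * nabla l (\<lambda>Y. w Y $ i $ j) X) = 0"
    unfolding sum.distrib sumw nb using scal[OF X] W1
    by (auto simp: sum_subtractf algebra_simps sum_negf)
qed

lemma integral_of_motion_gradient:
  assumes "\<And>X. X \<in> S \<Longrightarrow> \<exists>D. (J has_derivative D) (at X) \<and> D (F X) = 0"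
  shows "integral_of_motion_on S F J"
  unfolding integral_of_motion_on_def
proof (intro allI impI)
  fix T :: "real set" and c
  assume T: "open T" "is_interval T" "c ` T \<subseteq> S" "solves_on F T c"
  show "\<exists>C. \<forall>t\<in>T. J (c t) = C"
  proof (rule has_derivative_zero_constant)
    show "convex T" using T by (simp add: is_interval_convex)
    fix t assume t: "t \<in> T"
    with T have "c t \<in> S" by auto
    then obtain D where D: "(J has_derivative D) (at (c t))" "D (F (c t)) = 0"
      using assms by blast
    have "(c has_derivative (\<lambda>s. s *\<^sub>R F (c t))) (at t within T)"
      using T t unfolding solves_on_def has_vector_derivative_def
      by (auto intro: has_derivative_at_withinI)
    from has_derivative_compose[OF this D(1)]
    have "((\<lambda>t. J (c t)) has_derivative (\<lambda>s. D (s *\<^sub>R F (c t)))) (at t within T)" .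
    moreover have "D (s *\<^sub>R F (c t)) = 0" for s
      using linear_scale[OF has_derivative_linear[OF D(1)]] D(2) by simp
    ultimately show "((\<lambda>t. J (c t)) has_derivative (\<lambda>s. 0)) (at t within T)" by simp
  qed
qed

section \<open>Gradients of the elliptic integrals of motion\<close>

text \<open>
  Free of quotients, the conditions are visibly open.
\<close>

lemma phase_dom_eq: "phase_dom = {X. X$1 \<noteq> 0 \<and> 0 < X$2 * X$3 \<and> X$2 * X$3 < (X$2)\<^sup>2}"
proof -
  have "0 < z / y \<and> z / y < 1 \<longleftrightarrow> 0 < y * z \<and> y * z < y\<^sup>2" for y z :: real
  proof (cases "y = 0")
    case False
    then have y2: "0 < y\<^sup>2" by simp
    define q where "q = z / y"
    have "y * z = y\<^sup>2 * q" using False by (simp add: q_def power2_eq_square)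
    then show ?thesis
      unfolding q_def[symmetric] using y2
      by (simp add: zero_less_mult_iff mult_less_cancel_left2)
  qed simp
  then show ?thesis by (simp add: phase_dom_def)
qed

lemma open_phase_dom: "open phase_dom"
  unfolding phase_dom_eq
  by (intro open_Collect_conj open_Collect_neq open_Collect_less continuous_intros)

lemma phase_dom_facts:
  assumes "X \<in> phase_dom"
  shows "X$1 \<noteq> 0" "X$2 \<noteq> 0" "X$3 \<noteq> 0" "0 < X$3 / X$2" "X$3 / X$2 < 1"
    "0 < (X$3 / X$2)\<^sup>2" "(X$3 / X$2)\<^sup>2 < 1" "(X$2)\<^sup>2 - (X$3)\<^sup>2 \<noteq> 0"
proof -
  show *: "X$1 \<noteq> 0" "0 < X$3 / X$2" "X$3 / X$2 < 1"
    using assms by (auto simp: phase_dom_def)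
  then show **: "X$2 \<noteq> 0" "X$3 \<noteq> 0" by auto
  show "0 < (X$3 / X$2)\<^sup>2" using ** by simp
  show m: "(X$3 / X$2)\<^sup>2 < 1" using * by (simp add: abs_square_less_1)
  show "(X$2)\<^sup>2 - (X$3)\<^sup>2 \<noteq> 0" using m ** by (auto simp: power_divide)
qed

lemma J1_legendre:
  assumes "X \<in> phase_dom"
  shows "J1 X = 1 / X$2 * (X$4 + (- 2) * (X$2)\<^sup>2 + (X$3)\<^sup>2) * legendre_K ((X$3 / X$2)\<^sup>2)
    + 3 * X$2 * legendre_E ((X$3 / X$2)\<^sup>2)"
  using phase_dom_facts[OF assms] by (simp add: J1_def Let_def ell_K_eq ell_E_eq)

lemma J2_legendre:
  assumes "X \<in> phase_dom"
  shows "J2 X = 1 / X$2 * (X$4 + 1 * (X$2)\<^sup>2 + (X$3)\<^sup>2) * legendre_K (1 - (X$3 / X$2)\<^sup>2)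
    + (- 3) * X$2 * legendre_E (1 - (X$3 / X$2)\<^sup>2)"
  using phase_dom_facts[OF assms] by (simp add: J2_def Let_def ell_K'_eq ell_E'_eq)

lemma has_derivative_vec_nth: "((\<lambda>Y. Y $ i) has_derivative (\<lambda>h. h $ i)) F"
  by (intro bounded_linear_imp_has_derivative bounded_linear_vec_nth)

text \<open>
  \<open>J\<^sub>1\<close> and \<open>J\<^sub>2\<close> have the same shape: \<open>\<alpha> = -2, \<beta> = 3\<close> with \<open>f = K, g = E\<close>, and \<open>\<alpha> = 1, \<beta> = -3\<close>
  with the complementary integrals. The term \<open>s\<close> collects what depends on the derivatives of
  \<open>f\<close> and \<open>g\<close>; it enters both partial derivatives through that of \<open>(z / y)\<^sup>2\<close>.
\<close>

lemma elliptic_combination_has_derivative: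
  fixes X :: "real^4" and f g :: "real \<Rightarrow> real" and \<alpha> \<beta> :: real
  assumes X: "X$2 = y" "X$3 = z" "X$4 = u" and y: "y \<noteq> 0"
    and f: "(f has_real_derivative f') (at ((z / y)\<^sup>2))"
    and g: "(g has_real_derivative g') (at ((z / y)\<^sup>2))"
  defines "s \<equiv> (u + \<alpha> * y\<^sup>2 + z\<^sup>2) / y * f' + \<beta> * y * g'"
  shows "((\<lambda>Y. 1 / Y$2 * (Y$4 + \<alpha> * (Y$2)\<^sup>2 + (Y$3)\<^sup>2) * f ((Y$3 / Y$2)\<^sup>2)
      + \<beta> * Y$2 * g ((Y$3 / Y$2)\<^sup>2)) has_derivative
    (\<lambda>h. ((\<alpha> - (u + z\<^sup>2) / y\<^sup>2) * f ((z / y)\<^sup>2) + \<beta> * g ((z / y)\<^sup>2) - 2 * z\<^sup>2 / y ^ 3 * s) * h$2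
       + (2 * z / y * f ((z / y)\<^sup>2) + 2 * z / y\<^sup>2 * s) * h$3
       + f ((z / y)\<^sup>2) / y * h$4)) (at X)"
proof -
  note nth = has_derivative_vec_nth
  have inv: "((\<lambda>Y. 1 / Y$2) has_derivative (\<lambda>h. - h$2 / y\<^sup>2)) (at X)"
    using has_derivative_divide[OF has_derivative_const[of 1] nth[of 2], of X UNIV] X y
    by (simp add: power2_eq_square divide_simps)
  have quo: "((\<lambda>Y. Y$3 / Y$2) has_derivative (\<lambda>h. h$3 / y - z * h$2 / y\<^sup>2)) (at X)"
    using has_derivative_divide'[OF nth[of 3] nth[of 2], of X UNIV] X y
    by (simp add: power2_eq_square diff_divide_distrib)
  have modulus: "((\<lambda>Y. (Y$3 / Y$2)\<^sup>2) has_derivative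
      (\<lambda>h. 2 * z / y\<^sup>2 * h$3 - 2 * z\<^sup>2 / y ^ 3 * h$2)) (at X)"
    using has_derivative_power[OF quo, of 2] X y
    by (simp add: power2_eq_square power3_eq_cube right_diff_distrib mult_ac)
  have poly: "((\<lambda>Y. Y$4 + \<alpha> * (Y$2)\<^sup>2 + (Y$3)\<^sup>2) has_derivative
      (\<lambda>h. h$4 + \<alpha> * (2 * h$2 * y) + 2 * h$3 * z)) (at X)"
    using has_derivative_add[OF has_derivative_add[OF nth[of 4]
          has_derivative_mult_right[OF has_derivative_power[OF nth[of 2], of 2], of \<alpha>]]
        has_derivative_power[OF nth[of 3], of 2], of X UNIV] X
    by (simp add: mult_ac)
  have fm: "((\<lambda>Y. f ((Y$3 / Y$2)\<^sup>2)) has_derivative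
      (\<lambda>h. (2 * z / y\<^sup>2 * h$3 - 2 * z\<^sup>2 / y ^ 3 * h$2) * f')) (at X)"
    by (rule DERIV_compose_FDERIV[where f = f, OF _ modulus]) (simp add: f X)
  have gm: "((\<lambda>Y. g ((Y$3 / Y$2)\<^sup>2)) has_derivative
      (\<lambda>h. (2 * z / y\<^sup>2 * h$3 - 2 * z\<^sup>2 / y ^ 3 * h$2) * g')) (at X)"
    by (rule DERIV_compose_FDERIV[where f = g, OF _ modulus]) (simp add: g X)
  have lin: "((\<lambda>Y. \<beta> * Y$2) has_derivative (\<lambda>h. \<beta> * h$2)) (at X)"
    by (intro has_derivative_mult_right nth)
  show ?thesis
  proof (rule has_derivative_eq_rhs[OF has_derivative_add[OF
        has_derivative_mult[OF has_derivative_mult[OF inv poly] fm]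
        has_derivative_mult[OF lin gm]]], rule ext)
    fix h :: "real^4"
    define F G where "F = f ((z / y)\<^sup>2)" and "G = g ((z / y)\<^sup>2)"
    show "1 / X$2 * (X$4 + \<alpha> * (X$2)\<^sup>2 + (X$3)\<^sup>2) *
          ((2 * z / y\<^sup>2 * h$3 - 2 * z\<^sup>2 / y ^ 3 * h$2) * f')
        + (1 / X$2 * (h$4 + \<alpha> * (2 * h$2 * y) + 2 * h$3 * z)
            + - h$2 / y\<^sup>2 * (X$4 + \<alpha> * (X$2)\<^sup>2 + (X$3)\<^sup>2)) * f ((X$3 / X$2)\<^sup>2)
        + (\<beta> * X$2 * ((2 * z / y\<^sup>2 * h$3 - 2 * z\<^sup>2 / y ^ 3 * h$2) * g')
            + \<beta> * h$2 * g ((X$3 / X$2)\<^sup>2)) =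
      ((\<alpha> - (u + z\<^sup>2) / y\<^sup>2) * f ((z / y)\<^sup>2) + \<beta> * g ((z / y)\<^sup>2) - 2 * z\<^sup>2 / y ^ 3 * s) * h$2
       + (2 * z / y * f ((z / y)\<^sup>2) + 2 * z / y\<^sup>2 * s) * h$3
       + f ((z / y)\<^sup>2) / y * h$4"
      unfolding X F_def[symmetric] G_def[symmetric] s_def using y
      by (simp add: divide_simps power2_eq_square power3_eq_cube) (simp add: algebra_simps)
  qed
qed

text \<open>
  Expressing the derivatives of \<open>K\<close> and \<open>E\<close> through \<open>K\<close> and \<open>E\<close> keeps the gradient linear in
  these two with rational coefficients. The factors \<open>u - 2y\<^sup>2 + z\<^sup>2\<close> and \<open>u + y\<^sup>2 - 2z\<^sup>2\<close> of the vector
  field already appear in the coefficients of \<open>E\<close>.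
\<close>

lemma J1_has_derivative:
  assumes "X \<in> phase_dom" and X: "X$2 = y" "X$3 = z" "X$4 = u"
  defines "K \<equiv> legendre_K ((z / y)\<^sup>2)" and "E \<equiv> legendre_E ((z / y)\<^sup>2)"
  shows "(J1 has_derivative
    (\<lambda>h. (- K - (u - 2 * y\<^sup>2 + z\<^sup>2) * E / (y\<^sup>2 - z\<^sup>2)) * h$2
      + (y\<^sup>2 * (u + y\<^sup>2 - 2 * z\<^sup>2) * E - (y\<^sup>2 - z\<^sup>2) * (u + y\<^sup>2 - z\<^sup>2) * K) / (y * z * (y\<^sup>2 - z\<^sup>2)) * h$3
      + K / y * h$4)) (at X)"
proof -
  define d where "d = y\<^sup>2 - z\<^sup>2"
  have nz: "y \<noteq> 0" "z \<noteq> 0" "d \<noteq> 0"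
    and m: "(z / y)\<^sup>2 < 1" "(z / y)\<^sup>2 \<noteq> 0"
    using phase_dom_facts[OF assms(1)] by (simp_all add: X d_def)
  have m1: "1 - (z / y)\<^sup>2 = d / y\<^sup>2" using nz by (simp add: d_def power_divide diff_divide_distrib)
  have dK: "(legendre_K has_real_derivative (y\<^sup>2 * (y\<^sup>2 * E - d * K)) / (2 * z\<^sup>2 * d)) (at ((z / y)\<^sup>2))"
  proof (rule DERIV_cong[OF DERIV_legendre_K[OF m]])
    show "(legendre_E ((z / y)\<^sup>2) - (1 - (z / y)\<^sup>2) * legendre_K ((z / y)\<^sup>2)) / (2 * (z / y)\<^sup>2 * (1 - (z / y)\<^sup>2)) =
        (y\<^sup>2 * (y\<^sup>2 * E - d * K)) / (2 * z\<^sup>2 * d)"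
      unfolding m1 K_def[symmetric] E_def[symmetric] using nz
      by (simp add: divide_simps power2_eq_square)
  qed
  have dE: "(legendre_E has_real_derivative y\<^sup>2 * (E - K) / (2 * z\<^sup>2)) (at ((z / y)\<^sup>2))"
  proof (rule DERIV_cong[OF DERIV_legendre_E[OF m]])
    show "(legendre_E ((z / y)\<^sup>2) - legendre_K ((z / y)\<^sup>2)) / (2 * (z / y)\<^sup>2) = y\<^sup>2 * (E - K) / (2 * z\<^sup>2)"
      unfolding K_def[symmetric] E_def[symmetric] using nz
      by (simp add: divide_simps power2_eq_square)
  qed
  show ?thesis
  proof (rule has_derivative_transform_within_open[OF _ open_phase_dom assms(1)])
    show "1 / Y$2 * (Y$4 + (- 2) * (Y$2)\<^sup>2 + (Y$3)\<^sup>2) * legendre_K ((Y$3 / Y$2)\<^sup>2)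
      + 3 * Y$2 * legendre_E ((Y$3 / Y$2)\<^sup>2) = J1 Y" if "Y \<in> phase_dom" for Y
      using J1_legendre[OF that] by simp
    define s where "s = (u + (- 2) * y\<^sup>2 + z\<^sup>2) / y * ((y\<^sup>2 * (y\<^sup>2 * E - d * K)) / (2 * z\<^sup>2 * d))
        + 3 * y * (y\<^sup>2 * (E - K) / (2 * z\<^sup>2))"
    have s: "s = y * (y\<^sup>2 * (u + y\<^sup>2 - 2 * z\<^sup>2) * E - d * (u + y\<^sup>2 + z\<^sup>2) * K) / (2 * z\<^sup>2 * d)"
      unfolding s_def using nz
      by (simp add: divide_simps) (simp add: d_def algebra_simps power2_eq_square)
    have z: "2 * z / y * K + 2 * z / y\<^sup>2 * s =
        (y\<^sup>2 * (u + y\<^sup>2 - 2 * z\<^sup>2) * E - (y\<^sup>2 - z\<^sup>2) * (u + y\<^sup>2 - z\<^sup>2) * K) / (y * z * (y\<^sup>2 - z\<^sup>2))"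
      unfolding s d_def[symmetric] using nz
      by (simp add: divide_simps power2_eq_square) (simp add: algebra_simps)
    have y: "(- 2 - (u + z\<^sup>2) / y\<^sup>2) * K + 3 * E - 2 * z\<^sup>2 / y ^ 3 * s =
        - K - (u - 2 * y\<^sup>2 + z\<^sup>2) * E / (y\<^sup>2 - z\<^sup>2)"
      unfolding s d_def[symmetric] using nz
      by (simp add: divide_simps power3_eq_cube) (simp add: d_def algebra_simps power2_eq_square)
    show "((\<lambda>Y. 1 / Y$2 * (Y$4 + (- 2) * (Y$2)\<^sup>2 + (Y$3)\<^sup>2) * legendre_K ((Y$3 / Y$2)\<^sup>2)
      + 3 * Y$2 * legendre_E ((Y$3 / Y$2)\<^sup>2)) has_derivative
      (\<lambda>h. (- K - (u - 2 * y\<^sup>2 + z\<^sup>2) * E / (y\<^sup>2 - z\<^sup>2)) * h$2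
      + (y\<^sup>2 * (u + y\<^sup>2 - 2 * z\<^sup>2) * E - (y\<^sup>2 - z\<^sup>2) * (u + y\<^sup>2 - z\<^sup>2) * K) / (y * z * (y\<^sup>2 - z\<^sup>2)) * h$3
      + K / y * h$4)) (at X)"
      using elliptic_combination_has_derivative[OF X nz(1) dK dE, of "- 2" 3]
      unfolding K_def[symmetric] E_def[symmetric] s_def[symmetric] y z .
  qed
qed

lemma J2_has_derivative:
  assumes "X \<in> phase_dom" and X: "X$2 = y" "X$3 = z" "X$4 = u"
  defines "K \<equiv> legendre_K (1 - (z / y)\<^sup>2)" and "E \<equiv> legendre_E (1 - (z / y)\<^sup>2)"
  shows "(J2 has_derivative
    (\<lambda>h. ((y\<^sup>2 - u) * K + (u - 2 * y\<^sup>2 + z\<^sup>2) * E) / (y\<^sup>2 - z\<^sup>2) * h$2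
      + (z\<^sup>2 * (u - z\<^sup>2) * K - y\<^sup>2 * (u + y\<^sup>2 - 2 * z\<^sup>2) * E) / (y * z * (y\<^sup>2 - z\<^sup>2)) * h$3
      + K / y * h$4)) (at X)"
proof -
  define d where "d = y\<^sup>2 - z\<^sup>2"
  have nz: "y \<noteq> 0" "z \<noteq> 0" "d \<noteq> 0"
    and m: "0 < (z / y)\<^sup>2" "(z / y)\<^sup>2 < 1"
    using phase_dom_facts[OF assms(1)] by (simp_all add: X d_def)
  have m1: "1 - (z / y)\<^sup>2 = d / y\<^sup>2" using nz by (simp add: d_def power_divide diff_divide_distrib)
  have dK: "((\<lambda>m. legendre_K (1 - m)) has_real_derivative
      - (y\<^sup>2 * (y\<^sup>2 * E - z\<^sup>2 * K)) / (2 * z\<^sup>2 * d)) (at ((z / y)\<^sup>2))"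
  proof (rule DERIV_cong[OF DERIV_legendre_K_compl[OF m]])
    show "- (legendre_E (1 - (z / y)\<^sup>2) - (z / y)\<^sup>2 * legendre_K (1 - (z / y)\<^sup>2)) / (2 * (z / y)\<^sup>2 * (1 - (z / y)\<^sup>2)) =
        - (y\<^sup>2 * (y\<^sup>2 * E - z\<^sup>2 * K)) / (2 * z\<^sup>2 * d)"
      unfolding K_def[symmetric] E_def[symmetric] unfolding m1 using nz
      by (simp add: divide_simps power2_eq_square)
  qed
  have dE: "((\<lambda>m. legendre_E (1 - m)) has_real_derivative - (y\<^sup>2 * (E - K)) / (2 * d)) (at ((z / y)\<^sup>2))"
  proof (rule DERIV_cong[OF DERIV_legendre_E_compl[OF m]])
    show "- (legendre_E (1 - (z / y)\<^sup>2) - legendre_K (1 - (z / y)\<^sup>2)) / (2 * (1 - (z / y)\<^sup>2)) =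
        - (y\<^sup>2 * (E - K)) / (2 * d)"
      unfolding K_def[symmetric] E_def[symmetric] unfolding m1 using nz
      by (simp add: divide_simps power2_eq_square) (simp add: algebra_simps)
  qed
  show ?thesis
  proof (rule has_derivative_transform_within_open[OF _ open_phase_dom assms(1)])
    show "1 / Y$2 * (Y$4 + 1 * (Y$2)\<^sup>2 + (Y$3)\<^sup>2) * legendre_K (1 - (Y$3 / Y$2)\<^sup>2)
      + (- 3) * Y$2 * legendre_E (1 - (Y$3 / Y$2)\<^sup>2) = J2 Y" if "Y \<in> phase_dom" for Y
      using J2_legendre[OF that] by simp
    define s where "s = (u + 1 * y\<^sup>2 + z\<^sup>2) / y * (- (y\<^sup>2 * (y\<^sup>2 * E - z\<^sup>2 * K)) / (2 * z\<^sup>2 * d))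
        + (- 3) * y * (- (y\<^sup>2 * (E - K)) / (2 * d))"
    have s: "s = y * (z\<^sup>2 * (u - 2 * y\<^sup>2 + z\<^sup>2) * K - y\<^sup>2 * (u + y\<^sup>2 - 2 * z\<^sup>2) * E) / (2 * z\<^sup>2 * d)"
      unfolding s_def using nz
      by (simp add: divide_simps) (simp add: algebra_simps power2_eq_square)
    have z: "2 * z / y * K + 2 * z / y\<^sup>2 * s =
        (z\<^sup>2 * (u - z\<^sup>2) * K - y\<^sup>2 * (u + y\<^sup>2 - 2 * z\<^sup>2) * E) / (y * z * (y\<^sup>2 - z\<^sup>2))"
      unfolding s d_def[symmetric] using nz
      by (simp add: divide_simps power2_eq_square) (simp add: d_def algebra_simps power2_eq_square)
    have y: "(1 - (u + z\<^sup>2) / y\<^sup>2) * K + (- 3) * E - 2 * z\<^sup>2 / y ^ 3 * s =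
        ((y\<^sup>2 - u) * K + (u - 2 * y\<^sup>2 + z\<^sup>2) * E) / (y\<^sup>2 - z\<^sup>2)"
      unfolding s d_def[symmetric] using nz
      by (simp add: divide_simps power3_eq_cube) (simp add: d_def algebra_simps power2_eq_square)
    show "((\<lambda>Y. 1 / Y$2 * (Y$4 + 1 * (Y$2)\<^sup>2 + (Y$3)\<^sup>2) * legendre_K (1 - (Y$3 / Y$2)\<^sup>2)
      + (- 3) * Y$2 * legendre_E (1 - (Y$3 / Y$2)\<^sup>2)) has_derivative
      (\<lambda>h. ((y\<^sup>2 - u) * K + (u - 2 * y\<^sup>2 + z\<^sup>2) * E) / (y\<^sup>2 - z\<^sup>2) * h$2
      + (z\<^sup>2 * (u - z\<^sup>2) * K - y\<^sup>2 * (u + y\<^sup>2 - 2 * z\<^sup>2) * E) / (y * z * (y\<^sup>2 - z\<^sup>2)) * h$3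
      + K / y * h$4)) (at X)"
      using elliptic_combination_has_derivative[OF X nz(1) dK dE, of 1 "- 3"]
      unfolding K_def[symmetric] E_def[symmetric] s_def[symmetric] y z .
  qed
qed

section \<open>The bivector as a contraction\<close>

text \<open>
  In each \<open>2 \<times> 2\<close> minor the products of complete integrals combine to a polynomial multiple of
  \<open>E K' + E' K - K K'\<close>, which Legendre's relation replaces by \<open>\<pi>/2\<close>. This explains the factor
  \<open>2/\<pi>\<close> in \<open>c\<close> and in the multiplier of the Nambu bracket.
\<close>

lemma nabla_J_cross_products:
  assumes X: "X \<in> phase_dom"
  defines "P \<equiv> \<lambda>l. nabla l J1 X" and "Q \<equiv> \<lambda>l. nabla l J2 X"
    and "c \<equiv> 2 / pi * X$2 * X$3 * ((X$2)\<^sup>2 - (X$3)\<^sup>2)"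
  shows "P 1 = 0" "Q 1 = 0"
    and "c * (P 3 * Q 4 - P 4 * Q 3) = V_y X"
    and "c * (P 4 * Q 2 - P 2 * Q 4) = V_z X"
    and "c * (P 2 * Q 3 - P 3 * Q 2) = V_u X"
proof -
  define y z u where "y = X$2" and "z = X$3" and "u = X$4"
  define K E K' E' where "K = legendre_K ((z / y)\<^sup>2)" and "E = legendre_E ((z / y)\<^sup>2)"
    and "K' = legendre_K (1 - (z / y)\<^sup>2)" and "E' = legendre_E (1 - (z / y)\<^sup>2)"
  define d where "d = y\<^sup>2 - z\<^sup>2"
  have nz: "y \<noteq> 0" "z \<noteq> 0" "d \<noteq> 0"
    using phase_dom_facts[OF X] by (simp_all add: y_def z_def d_def)
  have leg: "E * K' + E' * K - K * K' = pi / 2"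
    unfolding K_def E_def K'_def E'_def
    by (rule legendre_relation) (use phase_dom_facts[OF X] in \<open>simp_all add: y_def z_def\<close>)
  note P = nabla_eq[OF J1_has_derivative[OF X y_def[symmetric] z_def[symmetric] u_def[symmetric]],
      folded P_def K_def E_def d_def]
  note Q = nabla_eq[OF J2_has_derivative[OF X y_def[symmetric] z_def[symmetric] u_def[symmetric]],
      folded Q_def K'_def E'_def d_def]
  show "P 1 = 0" "Q 1 = 0"
    unfolding P_def Q_def
    unfolding P[unfolded P_def] Q[unfolded Q_def] by (simp_all add: axis_def)
  have P': "P 2 = - K - (u - 2 * y\<^sup>2 + z\<^sup>2) * E / d"
    "P 3 = (y\<^sup>2 * (u + y\<^sup>2 - 2 * z\<^sup>2) * E - d * (u + y\<^sup>2 - z\<^sup>2) * K) / (y * z * d)"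
    "P 4 = K / y"
    unfolding P_def
    unfolding P[unfolded P_def] by (simp_all add: axis_def)
  have Q': "Q 2 = ((y\<^sup>2 - u) * K' + (u - 2 * y\<^sup>2 + z\<^sup>2) * E') / d"
    "Q 3 = (z\<^sup>2 * (u - z\<^sup>2) * K' - y\<^sup>2 * (u + y\<^sup>2 - 2 * z\<^sup>2) * E') / (y * z * d)"
    "Q 4 = K' / y"
    unfolding Q_def
    unfolding Q[unfolded Q_def] by (simp_all add: axis_def)
  have c: "c = 2 / pi * y * z * d" by (simp add: c_def y_def z_def d_def)
  have fin: "2 / pi * (v * (E * K' + E' * K - K * K')) = v" for v
    unfolding leg by simp
  have "c * (P 3 * Q 4 - P 4 * Q 3) =
      2 / pi * ((u + y\<^sup>2 - 2 * z\<^sup>2) * y * (E * K' + E' * K - K * K'))"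
    unfolding P' Q' c using nz
    by (simp add: divide_simps) (simp add: d_def algebra_simps power2_eq_square)
  then show "c * (P 3 * Q 4 - P 4 * Q 3) = V_y X"
    unfolding fin by (simp add: V_y_def Let_def y_def z_def u_def)
  have "c * (P 4 * Q 2 - P 2 * Q 4) =
      2 / pi * ((u - 2 * y\<^sup>2 + z\<^sup>2) * z * (E * K' + E' * K - K * K'))"
    unfolding P' Q' c using nz
    by (simp add: divide_simps) (simp add: d_def algebra_simps power2_eq_square)
  then show "c * (P 4 * Q 2 - P 2 * Q 4) = V_z X"
    unfolding fin by (simp add: V_z_def Let_def y_def z_def u_def)
  have "c * (P 2 * Q 3 - P 3 * Q 2) =
      2 / pi * ((u\<^sup>2 - y ^ 4 + y\<^sup>2 * z\<^sup>2 - z ^ 4) * (E * K' + E' * K - K * K'))"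
    unfolding P' Q' c using nz
    by (simp add: divide_simps) (simp add: d_def algebra_simps power2_eq_square power4_eq_xxxx)
  then show "c * (P 2 * Q 3 - P 3 * Q 2) = V_u X"
    unfolding fin by (simp add: V_u_def Let_def y_def z_def u_def)
qed

lemma J1_derivative_along_system:
  assumes X: "X \<in> phase_dom"
  shows "\<exists>D. (J1 has_derivative D) (at X) \<and> D (system_field X) = 0"
proof (intro exI conjI)
  define y z u where "y = X$2" and "z = X$3" and "u = X$4"
  define d where "d = y\<^sup>2 - z\<^sup>2"
  have nz: "y \<noteq> 0" "z \<noteq> 0" "d \<noteq> 0"
    using phase_dom_facts[OF X] by (simp_all add: y_def z_def d_def)
  show "(J1 has_derivative
    (\<lambda>h. (- legendre_K ((z / y)\<^sup>2) - (u - 2 * y\<^sup>2 + z\<^sup>2) * legendre_E ((z / y)\<^sup>2) / (y\<^sup>2 - z\<^sup>2)) * h$2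
      + (y\<^sup>2 * (u + y\<^sup>2 - 2 * z\<^sup>2) * legendre_E ((z / y)\<^sup>2)
          - (y\<^sup>2 - z\<^sup>2) * (u + y\<^sup>2 - z\<^sup>2) * legendre_K ((z / y)\<^sup>2)) / (y * z * (y\<^sup>2 - z\<^sup>2)) * h$3
      + legendre_K ((z / y)\<^sup>2) / y * h$4)) (at X)"
    by (rule J1_has_derivative[OF X]) (simp_all add: y_def z_def u_def)
  have V: "system_field X $ 2 = (u + y\<^sup>2 - 2 * z\<^sup>2) * y"
    "system_field X $ 3 = (u - 2 * y\<^sup>2 + z\<^sup>2) * z"
    "system_field X $ 4 = u\<^sup>2 - y ^ 4 + y\<^sup>2 * z\<^sup>2 - z ^ 4"
    by (simp_all add: system_field_def Let_def vector_4 y_def z_def u_def)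
  show "(- legendre_K ((z / y)\<^sup>2) - (u - 2 * y\<^sup>2 + z\<^sup>2) * legendre_E ((z / y)\<^sup>2) / (y\<^sup>2 - z\<^sup>2)) * system_field X $ 2
      + (y\<^sup>2 * (u + y\<^sup>2 - 2 * z\<^sup>2) * legendre_E ((z / y)\<^sup>2)
          - (y\<^sup>2 - z\<^sup>2) * (u + y\<^sup>2 - z\<^sup>2) * legendre_K ((z / y)\<^sup>2)) / (y * z * (y\<^sup>2 - z\<^sup>2)) * system_field X $ 3
      + legendre_K ((z / y)\<^sup>2) / y * system_field X $ 4 = 0"
  proof -
    have "(- K - (u - 2 * y\<^sup>2 + z\<^sup>2) * E / d) * ((u + y\<^sup>2 - 2 * z\<^sup>2) * y)
      + (y\<^sup>2 * (u + y\<^sup>2 - 2 * z\<^sup>2) * E - d * (u + y\<^sup>2 - z\<^sup>2) * K) / (y * z * d)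
          * ((u - 2 * y\<^sup>2 + z\<^sup>2) * z)
      + K / y * (u\<^sup>2 - y ^ 4 + y\<^sup>2 * z\<^sup>2 - z ^ 4) = 0" for K E
      using nz
      by (simp add: divide_simps) (simp add: d_def algebra_simps power2_eq_square power4_eq_xxxx)
    then show ?thesis unfolding V d_def .
  qed
qed

lemma J2_derivative_along_system:
  assumes X: "X \<in> phase_dom"
  shows "\<exists>D. (J2 has_derivative D) (at X) \<and> D (system_field X) = 0"
proof (intro exI conjI)
  define y z u where "y = X$2" and "z = X$3" and "u = X$4"
  define d where "d = y\<^sup>2 - z\<^sup>2"
  have nz: "y \<noteq> 0" "z \<noteq> 0" "d \<noteq> 0"
    using phase_dom_facts[OF X] by (simp_all add: y_def z_def d_def)
  show "(J2 has_derivative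
    (\<lambda>h. ((y\<^sup>2 - u) * legendre_K (1 - (z / y)\<^sup>2)
          + (u - 2 * y\<^sup>2 + z\<^sup>2) * legendre_E (1 - (z / y)\<^sup>2)) / (y\<^sup>2 - z\<^sup>2) * h$2
      + (z\<^sup>2 * (u - z\<^sup>2) * legendre_K (1 - (z / y)\<^sup>2)
          - y\<^sup>2 * (u + y\<^sup>2 - 2 * z\<^sup>2) * legendre_E (1 - (z / y)\<^sup>2)) / (y * z * (y\<^sup>2 - z\<^sup>2)) * h$3
      + legendre_K (1 - (z / y)\<^sup>2) / y * h$4)) (at X)"
    by (rule J2_has_derivative[OF X]) (simp_all add: y_def z_def u_def)
  have V: "system_field X $ 2 = (u + y\<^sup>2 - 2 * z\<^sup>2) * y"
    "system_field X $ 3 = (u - 2 * y\<^sup>2 + z\<^sup>2) * z"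
    "system_field X $ 4 = u\<^sup>2 - y ^ 4 + y\<^sup>2 * z\<^sup>2 - z ^ 4"
    by (simp_all add: system_field_def Let_def vector_4 y_def z_def u_def)
  have "((y\<^sup>2 - u) * K + (u - 2 * y\<^sup>2 + z\<^sup>2) * E) / d * ((u + y\<^sup>2 - 2 * z\<^sup>2) * y)
      + (z\<^sup>2 * (u - z\<^sup>2) * K - y\<^sup>2 * (u + y\<^sup>2 - 2 * z\<^sup>2) * E) / (y * z * d)
          * ((u - 2 * y\<^sup>2 + z\<^sup>2) * z)
      + K / y * (u\<^sup>2 - y ^ 4 + y\<^sup>2 * z\<^sup>2 - z ^ 4) = 0" for K E
    using nz
    by (simp add: divide_simps) (simp add: d_def algebra_simps power2_eq_square power4_eq_xxxx)
  then show "((y\<^sup>2 - u) * legendre_K (1 - (z / y)\<^sup>2)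
          + (u - 2 * y\<^sup>2 + z\<^sup>2) * legendre_E (1 - (z / y)\<^sup>2)) / (y\<^sup>2 - z\<^sup>2) * system_field X $ 2
      + (z\<^sup>2 * (u - z\<^sup>2) * legendre_K (1 - (z / y)\<^sup>2)
          - y\<^sup>2 * (u + y\<^sup>2 - 2 * z\<^sup>2) * legendre_E (1 - (z / y)\<^sup>2)) / (y * z * (y\<^sup>2 - z\<^sup>2)) * system_field X $ 3
      + legendre_K (1 - (z / y)\<^sup>2) / y * system_field X $ 4 = 0"
    unfolding V d_def .
qed

text \<open>
  The vector field \<open>W\<close> in \<open>\<omega> = \<partial>\<^sub>x \<and> W\<close>, with \<open>x / (2 \<H>)\<close> written as \<open>x\<^sup>3 / (y\<^sup>2 - z\<^sup>2)\<close> to display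
  its homogeneity in \<open>x\<close>.
\<close>

definition wedge_coeff :: "4 \<Rightarrow> real^4 \<Rightarrow> real" where
  "wedge_coeff k Y = (Y$1) ^ 3 / ((Y$2)\<^sup>2 - (Y$3)\<^sup>2) *
     (if k = 2 then V_y Y else if k = 3 then V_z Y else if k = 4 then V_u Y else 0)"

text \<open>
  The identity holds at every point, because division by zero makes both sides vanish where
  \<open>x = 0\<close> or \<open>y\<^sup>2 = z\<^sup>2\<close>.
\<close>

lemma omega_eq_wedge:
  "omega Y $ j $ k = (if j = 1 then wedge_coeff k Y else 0) - (if k = 1 then wedge_coeff j Y else 0)"
proof -
  have "2 * Ham Y = ((Y$2)\<^sup>2 - (Y$3)\<^sup>2) / (Y$1)\<^sup>2"
    unfolding Ham_def Let_def by linarith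
  then have "Y$1 / (2 * Ham Y) = (Y$1) ^ 3 / ((Y$2)\<^sup>2 - (Y$3)\<^sup>2)"
    by (simp add: power2_eq_square power3_eq_cube)
  then show ?thesis
    using exhaust_4[of j] exhaust_4[of k]
    by (elim disjE) (simp_all add: omega_def wedge_coeff_def vector_4)
qed

lemma wedge_coeff_differentiable:
  assumes "X \<in> phase_dom"
  shows "wedge_coeff k differentiable (at X)"
proof -
  have nth: "(\<lambda>Y. Y $ i) differentiable (at X)" for i :: 4
    using has_derivative_vec_nth by (auto simp: differentiable_def)
  have V: "V_y differentiable (at X)" "V_z differentiable (at X)" "V_u differentiable (at X)"
    unfolding V_y_def[abs_def] V_z_def[abs_def] V_u_def[abs_def] Let_def
    by (intro differentiable_add differentiable_diff differentiable_mult differentiable_power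
        differentiable_const nth)+
  have "(\<lambda>Y. (Y$1) ^ 3 / ((Y$2)\<^sup>2 - (Y$3)\<^sup>2)) differentiable (at X)"
    using phase_dom_facts[OF assms]
    by (intro differentiable_divide differentiable_diff differentiable_power nth)
  moreover have "(\<lambda>Y. if k = 2 then V_y Y else if k = 3 then V_z Y else if k = 4 then V_u Y else 0)
      differentiable (at X)"
    using V by (cases "k = 2"; cases "k = 3"; cases "k = 4") simp_all
  ultimately show ?thesis
    unfolding wedge_coeff_def[abs_def] by (rule differentiable_mult)
qed

lemma nabla_1_wedge_coeff:
  assumes "X \<in> phase_dom"
  shows "nabla 1 (wedge_coeff k) X = 3 / X$1 * wedge_coeff k X"
proof -
  define g where "g = 1 / ((X$2)\<^sup>2 - (X$3)\<^sup>2) *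
     (if k = 2 then V_y X else if k = 3 then V_z X else if k = 4 then V_u X else 0)"
  have "wedge_coeff k (X + t *\<^sub>R axis 1 1) = (X$1 + t) ^ 3 * g" for t
    by (simp add: wedge_coeff_def g_def V_y_def V_z_def V_u_def Let_def axis_def)
  moreover have "((\<lambda>t. (X$1 + t) ^ 3 * g) has_real_derivative 3 * (X$1)\<^sup>2 * g) (at 0)"
    by (auto intro!: derivative_eq_intros)
  ultimately have "nabla 1 (wedge_coeff k) X = 3 * (X$1)\<^sup>2 * g"
    unfolding nabla_def by (simp add: DERIV_imp_deriv)
  then show ?thesis
    using phase_dom_facts(1)[OF assms]
    by (simp add: wedge_coeff_def g_def power2_eq_square power3_eq_cube)
qed

lemma omega_poisson: "poisson_tensor_on phase_dom omega"
proof (rule poisson_tensor_wedge[where W = wedge_coeff and c = "\<lambda>X. 3 / X$1"])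
  show "wedge_coeff 1 Y = 0" for Y by (simp add: wedge_coeff_def)
qed (simp_all add: omega_eq_wedge wedge_coeff_differentiable nabla_1_wedge_coeff)

text \<open>
  Since \<open>J\<^sub>1\<close> and \<open>J\<^sub>2\<close> do not depend on \<open>x\<close>, the contraction vanishes unless one of \<open>j, k\<close> is 1;
  its first row is the cross product of the gradients.
\<close>

lemma omega_eq_levi_civita:
  assumes X: "X \<in> phase_dom"
  shows "omega X $ j $ k = 2 / pi * (X$1) ^ 3 * X$2 * X$3 *
         (\<Sum>l\<in>UNIV. \<Sum>n\<in>UNIV. levi_civita j k l n * nabla l J1 X * nabla n J2 X)"
proof -
  define P Q where "P l = nabla l J1 X" and "Q l = nabla l J2 X" for l
  define S where "S j k = (\<Sum>l\<in>UNIV. \<Sum>n\<in>UNIV. levi_civita j k l n * P l * Q n)" for j k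
  define d where "d = (X$2)\<^sup>2 - (X$3)\<^sup>2"
  have d: "d \<noteq> 0" using phase_dom_facts[OF X] by (simp add: d_def)
  note S = levi_civita_contraction[where a = P and b = Q, folded S_def]
  note cross = nabla_J_cross_products[OF X, folded P_def Q_def]
  have first_row: "2 / pi * (X$1) ^ 3 * X$2 * X$3 * S 1 k = wedge_coeff k X" for k
  proof -
    have *: "2 / pi * (X$1) ^ 3 * X$2 * X$3 * s = (X$1) ^ 3 / d * (2 / pi * X$2 * X$3 * d * s)" for s
      using d by simp
    show ?thesis
      unfolding * using exhaust_4[of k] cross(3-5)
      by (elim disjE) (simp_all add: S(1-3,7) wedge_coeff_def d_def[symmetric])
  qed
  have "2 / pi * (X$1) ^ 3 * X$2 * X$3 * S j k =
      (if j = 1 then wedge_coeff k X else 0) - (if k = 1 then wedge_coeff j X else 0)"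
  proof -
    consider "j = 1" | "k = 1" "j \<noteq> 1" | "j \<noteq> 1" "k \<noteq> 1" by blast
    then show ?thesis
    proof cases
      case 1
      then show ?thesis
        using first_row[of k] by (simp add: wedge_coeff_def)
    next
      case 2
      have "S j 1 = - S 1 j" by (rule S(8))
      then show ?thesis using 2 first_row[of j] by simp
    next
      case 3
      have "S 3 2 = - S 2 3" "S 4 2 = - S 2 4" "S 4 3 = - S 3 4" by (rule S(8))+
      then have "S j k = 0"
        using 3 exhaust_4[of j] exhaust_4[of k] cross(1,2) by (elim disjE) (simp_all add: S(4-7))
      then show ?thesis using 3 by simp
    qed
  qed
  then show ?thesis
    unfolding omega_eq_wedge S_def P_def Q_def by simp
qed

section \<open>Reduction of the Nambu bracket\<close>

text \<open>
  Passing from \<open>J\<^sub>1, J\<^sub>2\<close> to \<open>I\<^sub>2, I\<^sub>1\<close> brings one minus sign from the gradient of \<open>1 / (\<lambda> J\<^sub>1)\<close> and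
  another from the exchange of the last two slots; the remaining factor \<open>\<lambda> J\<^sub>1\<^sup>2\<close> is the one in
  \<open>\<Xi>\<^sup>-\<^sup>1\<close>.
\<close>

lemma omega_bracket_eq_nambu_bracket:
  assumes X: "X \<in> nambu_dom" and lam: "lam \<noteq> 0"
  shows "omega_bracket f1 f2 X = nambu_bracket lam f1 f2 I2 (I1 lam) X"
proof -
  have XP: "X \<in> phase_dom" and J1: "J1 X \<noteq> 0" using X by (simp_all add: nambu_dom_def)
  have "J1 differentiable (at X)"
    using J1_derivative_along_system[OF XP] by (auto simp: differentiable_def)
  note n1 = nabla_I1[OF lam J1 this]
  have n2: "I2 = J2" by (simp add: I2_def fun_eq_iff)
  define m where "m = lam * (J1 X)\<^sup>2"
  have m: "m \<noteq> 0" using lam J1 by (simp add: m_def)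
  have inner: "Xi_inv lam X * (\<Sum>l\<in>UNIV. \<Sum>n\<in>UNIV. levi_civita j k l n * nabla l I2 X * nabla n (I1 lam) X)
      = omega X $ j $ k" for j k
  proof -
    define S where "S = (\<Sum>l\<in>UNIV. \<Sum>n\<in>UNIV. levi_civita j k l n * nabla l J1 X * nabla n J2 X)"
    have "(\<Sum>l\<in>UNIV. \<Sum>n\<in>UNIV. levi_civita j k l n * nabla l I2 X * nabla n (I1 lam) X) =
        (\<Sum>l\<in>UNIV. \<Sum>n\<in>UNIV. levi_civita j k l n * nabla l J2 X * nabla n J1 X) * (- 1 / m)"
      unfolding n1 n2 m_def[symmetric] sum_distrib_right by (intro sum.cong refl) simp
    also have "\<dots> = S / m"
      unfolding levi_civita_contraction_swap[of j k "\<lambda>l. nabla l J2 X"] S_def by simp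
    finally show ?thesis
      unfolding omega_eq_levi_civita[OF XP] S_def[symmetric]
      using m by (simp add: Xi_inv_def m_def mult_ac)
  qed
  have "nambu_bracket lam f1 f2 I2 (I1 lam) X =
      (\<Sum>j\<in>UNIV. \<Sum>k\<in>UNIV. (Xi_inv lam X *
        (\<Sum>l\<in>UNIV. \<Sum>n\<in>UNIV. levi_civita j k l n * nabla l I2 X * nabla n (I1 lam) X))
        * nabla j f1 X * nabla k f2 X)"
    unfolding nambu_bracket_def sum_distrib_left sum_distrib_right
    by (intro sum.cong refl) (simp only: mult_ac)
  then show ?thesis
    unfolding inner omega_bracket_def by simp
qed

lemma nabla_Ham:
  assumes "X$1 \<noteq> 0"
  shows "nabla 1 Ham X = - ((X$2)\<^sup>2 - (X$3)\<^sup>2) / (X$1) ^ 3"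
    and "nabla 2 Ham X = X$2 / (X$1)\<^sup>2"
    and "nabla 3 Ham X = - X$3 / (X$1)\<^sup>2"
    and "nabla 4 Ham X = 0"
proof -
  note coords = Ham_def Let_def axis_def
  define x y z where "x = X$1" and "y = X$2" and "z = X$3"
  have x: "x \<noteq> 0" using assms by (simp add: x_def)
  have "((\<lambda>t. 1 / 2 * ((y\<^sup>2 - z\<^sup>2) / (x + t)\<^sup>2)) has_real_derivative - (y\<^sup>2 - z\<^sup>2) / x ^ 3) (at 0)"
  proof -
    have "((\<lambda>t. 1 / 2 * ((y\<^sup>2 - z\<^sup>2) / (x + t)\<^sup>2)) has_real_derivative
        1 / 2 * ((0 * (x + 0)\<^sup>2 - (y\<^sup>2 - z\<^sup>2) * (2 * x)) / ((x + 0)\<^sup>2 * (x + 0)\<^sup>2))) (at 0)"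
      using x by (intro DERIV_cmult DERIV_divide DERIV_const) (auto intro!: derivative_eq_intros)
    also have "1 / 2 * ((0 * (x + 0)\<^sup>2 - (y\<^sup>2 - z\<^sup>2) * (2 * x)) / ((x + 0)\<^sup>2 * (x + 0)\<^sup>2))
        = - (y\<^sup>2 - z\<^sup>2) / x ^ 3"
      using x by (simp add: divide_simps power2_eq_square power3_eq_cube)
    finally show ?thesis .
  qed
  then show "nabla 1 Ham X = - ((X$2)\<^sup>2 - (X$3)\<^sup>2) / (X$1) ^ 3"
    unfolding nabla_def by (simp add: coords x_def y_def z_def DERIV_imp_deriv)
  have "((\<lambda>t. 1 / 2 * (((y + t)\<^sup>2 - z\<^sup>2) / x\<^sup>2)) has_real_derivative 1 / 2 * ((2 * y) / x\<^sup>2)) (at 0)"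
    by (intro DERIV_cmult DERIV_cdivide) (auto intro!: derivative_eq_intros)
  then show "nabla 2 Ham X = X$2 / (X$1)\<^sup>2"
    unfolding nabla_def by (simp add: coords x_def y_def z_def DERIV_imp_deriv)
  have "((\<lambda>t. 1 / 2 * ((y\<^sup>2 - (z + t)\<^sup>2) / x\<^sup>2)) has_real_derivative 1 / 2 * ((- (2 * z)) / x\<^sup>2)) (at 0)"
    by (intro DERIV_cmult DERIV_cdivide) (auto intro!: derivative_eq_intros)
  then show "nabla 3 Ham X = - X$3 / (X$1)\<^sup>2"
    unfolding nabla_def by (simp add: coords x_def y_def z_def DERIV_imp_deriv)
  show "nabla 4 Ham X = 0"
    unfolding nabla_def by (simp add: coords)
qed

lemma system_field_eq_omega_field:
  assumes X: "X \<in> phase_dom"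
  shows "system_field X = omega_field Ham X"
proof -
  define x y z u where "x = X$1" and "y = X$2" and "z = X$3" and "u = X$4"
  define d where "d = y\<^sup>2 - z\<^sup>2"
  have nz: "x \<noteq> 0" "d \<noteq> 0"
    using phase_dom_facts[OF X] by (simp_all add: x_def y_def z_def d_def)
  note grad = nabla_Ham[OF phase_dom_facts(1)[OF X], folded x_def y_def z_def, folded d_def]
  have W: "wedge_coeff 1 X = 0" "wedge_coeff 2 X = x ^ 3 / d * ((u + y\<^sup>2 - 2 * z\<^sup>2) * y)"
    "wedge_coeff 3 X = x ^ 3 / d * ((u - 2 * y\<^sup>2 + z\<^sup>2) * z)"
    "wedge_coeff 4 X = x ^ 3 / d * (u\<^sup>2 - y ^ 4 + y\<^sup>2 * z\<^sup>2 - z ^ 4)"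
    by (simp_all add: wedge_coeff_def V_y_def V_z_def V_u_def Let_def x_def y_def z_def u_def d_def)
  have field: "omega_field Ham X $ i = (\<Sum>k\<in>UNIV. omega X $ i $ k * nabla k Ham X)" for i
    using exhaust_4[of i]
    by (elim disjE) (simp_all add: omega_field_def omega_bracket_def nabla_coordinate sum_4)
  have "system_field X $ i = omega_field Ham X $ i" for i
  proof -
    consider "i = 1" | "i = 2" | "i = 3" | "i = 4" using exhaust_4 by blast
    then show ?thesis
    proof cases
      case 1
      have "(u + y\<^sup>2 + z\<^sup>2) * x = x ^ 3 / d * ((u + y\<^sup>2 - 2 * z\<^sup>2) * y) * (y / x\<^sup>2)
          + x ^ 3 / d * ((u - 2 * y\<^sup>2 + z\<^sup>2) * z) * (- z / x\<^sup>2)"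
        using nz by (simp add: divide_simps) (simp add: d_def algebra_simps power2_eq_square power3_eq_cube)
      then show ?thesis
        unfolding field 1 omega_eq_wedge sum_4
        by (simp add: grad W) (simp add: system_field_def Let_def vector_4 x_def y_def z_def u_def)
    qed (use nz in \<open>simp_all add: field sum_4 omega_eq_wedge grad W system_field_def Let_def vector_4\<close>,
         simp_all add: x_def y_def z_def u_def)
  qed
  then show ?thesis by (simp add: vec_eq_iff)
qed

theorem mainTheorem15:
  fixes lam :: real
  assumes "lam \<noteq> 0"
  shows "poisson_tensor_on phase_dom omega \<and>
    integral_of_motion_on nambu_dom system_field (I1 lam) \<and>
    integral_of_motion_on phase_dom system_field I2 \<and>
    (\<forall>X\<in>nambu_dom. \<forall>f1 f2. f1 differentiable (at X) \<longrightarrow> f2 differentiable (at X) \<longrightarrow>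
       omega_bracket f1 f2 X = nambu_bracket lam f1 f2 I2 (I1 lam) X) \<and>
    (\<forall>X\<in>phase_dom. \<forall>j k.
       omega X $ j $ k = 2 / pi * (X$1)^3 * X$2 * X$3 *
         (\<Sum>l\<in>UNIV. \<Sum>n\<in>UNIV. levi_civita j k l n * nabla l J1 X * nabla n J2 X)) \<and>
    (\<forall>X\<in>nambu_dom. system_field X = nambu_field lam Ham I2 (I1 lam) X) \<and>
    (\<forall>X\<in>phase_dom. system_field X = omega_field Ham X) \<and>
    (\<forall>T c. open T \<longrightarrow> is_interval T \<longrightarrow> c ` T \<subseteq> nambu_dom \<longrightarrow>
       (solves_on system_field T c \<longleftrightarrow> solves_on (nambu_field lam Ham I2 (I1 lam)) T c) \<and>
       (solves_on (nambu_field lam Ham I2 (I1 lam)) T c \<longleftrightarrow> solves_on (omega_field Ham) T c))"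
proof -
  have sub: "nambu_dom \<subseteq> phase_dom" by (auto simp: nambu_dom_def)
  have J1: "integral_of_motion_on phase_dom system_field J1"
    by (intro integral_of_motion_gradient J1_derivative_along_system)
  have I1: "integral_of_motion_on nambu_dom system_field (I1 lam)"
    unfolding integral_of_motion_on_def
  proof (intro allI impI)
    fix T and c :: "real \<Rightarrow> real^4"
    assume "open T" "is_interval T" "c ` T \<subseteq> nambu_dom" "solves_on system_field T c"
    with sub have "\<exists>C. \<forall>t\<in>T. J1 (c t) = C"
      by (intro J1[unfolded integral_of_motion_on_def, rule_format]) auto
    then obtain C where "\<forall>t\<in>T. J1 (c t) = C" by blast
    then have "\<forall>t\<in>T. I1 lam (c t) = inverse (lam * C)" by (simp add: I1_def)
    then show "\<exists>C. \<forall>t\<in>T. I1 lam (c t) = C" by blast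
  qed
  have I2: "integral_of_motion_on phase_dom system_field I2"
    unfolding I2_def[abs_def]
    by (intro integral_of_motion_gradient J2_derivative_along_system)
  have omega_field: "system_field X = omega_field Ham X" if "X \<in> phase_dom" for X
    using that by (rule system_field_eq_omega_field)
  have nambu_field: "nambu_field lam Ham I2 (I1 lam) X = omega_field Ham X" if "X \<in> nambu_dom" for X
    unfolding nambu_field_def omega_field_def
    by (simp only: omega_bracket_eq_nambu_bracket[OF that assms])
  have solves: "solves_on F T c \<longleftrightarrow> solves_on G T c"
    if "c ` T \<subseteq> nambu_dom" "\<And>X. X \<in> nambu_dom \<Longrightarrow> F X = G X" for F G T and c :: "real \<Rightarrow> real^4"
    unfolding solves_on_def using that by (metis image_subset_iff)
  show ?thesis
  proof (intro conjI ballI allI impI)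
    show "system_field X = nambu_field lam Ham I2 (I1 lam) X" if "X \<in> nambu_dom" for X
      using that sub omega_field nambu_field by auto
    fix T and c :: "real \<Rightarrow> real^4"
    assume "c ` T \<subseteq> nambu_dom"
    then show "solves_on system_field T c \<longleftrightarrow> solves_on (nambu_field lam Ham I2 (I1 lam)) T c"
      and "solves_on (nambu_field lam Ham I2 (I1 lam)) T c \<longleftrightarrow> solves_on (omega_field Ham) T c"
      by (rule solves; use sub omega_field nambu_field in auto)+
  next
    show "omega X $ j $ k = 2 / pi * (X$1)^3 * X$2 * X$3 *
         (\<Sum>l\<in>UNIV. \<Sum>n\<in>UNIV. levi_civita j k l n * nabla l J1 X * nabla n J2 X)"
      if "X \<in> phase_dom" for X j k
      using that by (rule omega_eq_levi_civita)
    show "omega_bracket f1 f2 X = nambu_bracket lam f1 f2 I2 (I1 lam) X"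
      if "X \<in> nambu_dom" for X f1 f2
      using that assms by (rule omega_bracket_eq_nambu_bracket)
  qed (fact omega_poisson I1 I2 | rule omega_field, assumption)+
qed

end
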